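(* Let $a\in[0,1)$ and $q_a:=\min\big(\log_2(2-a),\tfrac12\big)$. If the complex potential $V=\mathrm{diag}(v_1,v_2,\dots)$ satisfies, for some constant $c<1$ and some $q\in(0,q_a]$, \[ |v_n|\le c\Big[2-\Big(1-\frac1n\Big)^q-\Big(1+\frac1n\Big)^q-a\,\delta_{n,1}\Big]\qquad\text{for all } n\in\mathbb{N}, \] then $\sigma(J_a+V)=\sigma_{\mathrm c}(J_a+V)=[-2,2]$. If this condition is fulfilled with $c=1$, then $\sigma_{\mathrm d}(J_a+V)=\emptyset$.
   Context: $\mathbb{N}=\{1,2,\dots\}$. For $a\in\mathbb{C}$, $J_a$ is the operator on $\ell^2(\mathbb{N})$ with $(J_a\psi)_1=a\psi_1+\psi_2$ and $(J_a\psi)_n=\psi_{n-1}+\psi_{n+1}$ for $n\ge2$. $\sigma_{\mathrm c}$ denotes the continuous spectrum and $\sigma_{\mathrm d}$ the discrete spectrum (isolated eigenvalues of finite algebraic multiplicity). *)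

theory Defs
  imports Complex_Main
begin

text \<open>Sequences on \<open>\<nat> = {1,2,...}\<close> are represented as functions \<open>nat \<Rightarrow> complex\<close>
  whose value at index 0 is 0 (index 0 is a dummy). Index n \<ge> 1 is the paper's index n.\<close>

definition ell2 :: "(nat \<Rightarrow> complex) set" where
  "ell2 = {\<psi>. \<psi> 0 = 0 \<and> summable (\<lambda>n. (cmod (\<psi> n))\<^sup>2)}"

definition l2norm :: "(nat \<Rightarrow> complex) \<Rightarrow> real" where
  "l2norm \<psi> = sqrt (\<Sum>n. (cmod (\<psi> n))\<^sup>2)"

definition JV :: "real \<Rightarrow> (nat \<Rightarrow> complex) \<Rightarrow> (nat \<Rightarrow> complex) \<Rightarrow> (nat \<Rightarrow> complex)" where
  "JV a v \<psi> = (\<lambda>n. if n = 0 then 0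
      else \<psi> (n - 1) + \<psi> (n + 1) + (complex_of_real a * (if n = 1 then 1 else 0) + v n) * \<psi> n)"

definition shiftop :: "((nat \<Rightarrow> complex) \<Rightarrow> (nat \<Rightarrow> complex)) \<Rightarrow> complex
    \<Rightarrow> (nat \<Rightarrow> complex) \<Rightarrow> (nat \<Rightarrow> complex)" where
  "shiftop T z \<psi> = (\<lambda>n. T \<psi> n - z * \<psi> n)"

definition resolvent_set :: "((nat \<Rightarrow> complex) \<Rightarrow> (nat \<Rightarrow> complex)) \<Rightarrow> complex set" where
  "resolvent_set T = {z. bij_betw (shiftop T z) ell2 ell2 \<and>
      (\<exists>C. \<forall>\<psi>\<in>ell2. l2norm \<psi> \<le> C * l2norm (shiftop T z \<psi>))}"

definition op_spectrum :: "((nat \<Rightarrow> complex) \<Rightarrow> (nat \<Rightarrow> complex)) \<Rightarrow> complex set" where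
  "op_spectrum T = - resolvent_set T"

definition cont_spectrum :: "((nat \<Rightarrow> complex) \<Rightarrow> (nat \<Rightarrow> complex)) \<Rightarrow> complex set" where
  "cont_spectrum T = {z \<in> op_spectrum T. inj_on (shiftop T z) ell2 \<and>
      (\<forall>\<phi>\<in>ell2. \<forall>\<epsilon>>0. \<exists>\<psi>\<in>ell2. l2norm (\<lambda>n. \<phi> n - shiftop T z \<psi> n) < \<epsilon>)}"

definition is_eigenvalue :: "((nat \<Rightarrow> complex) \<Rightarrow> (nat \<Rightarrow> complex)) \<Rightarrow> complex \<Rightarrow> bool" where
  "is_eigenvalue T z \<longleftrightarrow> (\<exists>\<psi>\<in>ell2. \<psi> \<noteq> (\<lambda>_. 0) \<and> shiftop T z \<psi> = (\<lambda>_. 0))"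

definition gen_eigenspace :: "((nat \<Rightarrow> complex) \<Rightarrow> (nat \<Rightarrow> complex)) \<Rightarrow> complex \<Rightarrow> (nat \<Rightarrow> complex) set" where
  "gen_eigenspace T z = {\<psi>\<in>ell2. \<exists>k. (shiftop T z ^^ k) \<psi> = (\<lambda>_. 0)}"

definition fin_dim :: "(nat \<Rightarrow> complex) set \<Rightarrow> bool" where
  "fin_dim K \<longleftrightarrow> (\<exists>m::nat. \<exists>b :: nat \<Rightarrow> nat \<Rightarrow> complex.
      \<forall>\<psi>\<in>K. \<exists>c :: nat \<Rightarrow> complex. \<psi> = (\<lambda>k. \<Sum>i<m. c i * b i k))"

definition disc_spectrum :: "((nat \<Rightarrow> complex) \<Rightarrow> (nat \<Rightarrow> complex)) \<Rightarrow> complex set" where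
  "disc_spectrum T = {z \<in> op_spectrum T. is_eigenvalue T z \<and>
      (\<exists>\<epsilon>>0. \<forall>w\<in>op_spectrum T. w \<noteq> z \<longrightarrow> \<epsilon> \<le> cmod (w - z)) \<and>
      fin_dim (gen_eigenspace T z)}"

definition hardy_weight :: "real \<Rightarrow> real \<Rightarrow> nat \<Rightarrow> real" where
  "hardy_weight a q n = 2 - (1 - 1 / real n) powr q - (1 + 1 / real n) powr q
      - a * (if n = 1 then 1 else 0)"

end

theory Submission
  imports Defs "HOL-Analysis.Convex" "HOL-Analysis.L2_Norm"
begin

text \<open>Write \<open>z = k + 1 / k\<close> with \<open>0 < |k| \<le> 1\<close>. The Green kernel of \<open>J\<^sub>a - z\<close> is bounded entrywise by
  the one at \<open>k = 1\<close>, and the latter applied to \<open>\<rho> g\<close>, where \<open>g\<^sub>n = n\<^sup>q\<close> and \<open>\<rho>\<close> is the Hardy weight, is at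
  most \<open>g\<close>, because \<open>(2 - J\<^sub>a) g = \<rho> g\<close>. Hence an eigenvector \<open>\<psi>\<close> would violate a maximum principle
  for \<open>|\<psi>| / g\<close>, so neither \<open>J\<^sub>a + V\<close> nor its adjoint has eigenvalues, anywhere in the plane: all
  operators \<open>J\<^sub>a + V - z\<close> are injective with dense range. For \<open>c < 1\<close> and \<open>|k| < 1\<close> the same maximum
  principle bounds \<open>sup |\<psi>| / g\<close> by \<open>\<parallel>(J\<^sub>a + V - z) \<psi>\<parallel>\<close>, hence also \<open>\<parallel>V \<psi>\<parallel>\<close> since \<open>\<rho> g\<close> is summable, and the
  invertibility of \<open>J\<^sub>0 - z\<close> turns this into a lower bound for \<open>J\<^sub>a + V - z\<close>. For \<open>|k| = 1\<close> truncations of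
  \<open>k\<^sup>n\<close> show that there is no such bound.\<close>

subsection \<open>The Green kernel\<close>

text \<open>\<open>jost_quot a k (m - 1) * k\<close> is the diagonal entry at \<open>m\<close> of \<open>(k + 1 / k - J\<^sub>a)\<^sup>-\<^sup>1\<close>.\<close>

primrec jost_quot :: "'a::field \<Rightarrow> 'a \<Rightarrow> nat \<Rightarrow> 'a" where
  "jost_quot a k 0 = 1 / (1 - a * k)"
| "jost_quot a k (Suc n) = 1 + k\<^sup>2 * jost_quot a k n"

text \<open>The truncated differences add up to |m - n|. The value 0 at the dummy index lets the
  boundary site obey the same recurrence as the others. The field is general because the kernel is
  used both for complex \<open>k\<close> and for real \<open>k = 1\<close>.\<close>

definition green :: "'a::field \<Rightarrow> 'a \<Rightarrow> nat \<Rightarrow> nat \<Rightarrow> 'a" where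
  "green a k m n = (if n = 0 then 0
     else jost_quot a k (min (m - 1) (n - 1)) * k ^ Suc ((m - n) + (n - m)))"

lemma green_0 [simp]: "green a k m 0 = 0"
  by (simp add: green_def)

text \<open>Left of \<open>m\<close> the recursion of \<open>jost_quot\<close> encodes the solution
  obeying the boundary condition, right of \<open>m\<close> the kernel is a multiple of a power of
  \<open>k\<close>; the two only fail to match at the diagonal, which leaves -1. The index
  \<open>n\<close> stands for the site \<open>n + 1\<close>, so \<open>a\<close> enters at
  \<open>n = 0\<close>.\<close>

lemma green_equation:
  fixes a k :: "'a::field"
  assumes k: "k \<noteq> 0" and ak: "a * k \<noteq> 1" and m: "m \<ge> 1"
  shows "green a k m n + green a k m (Suc (Suc n))
           + ((if n = 0 then a else 0) - (k + 1 / k)) * green a k m (Suc n)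
         = (if Suc n = m then - 1 else 0)"
proof -
  obtain i where i: "m = Suc i" using m by (cases m) auto
  consider "n < i" | "n = i" | "n > i" by linarith
  then show ?thesis
  proof cases
    case 1
    then obtain d where d: "i = Suc (n + d)" by  (metis less_iff_Suc_add)
    show ?thesis
    proof (cases n)
      case 0
      then show ?thesis using d i k ak
        by (simp add: green_def field_simps power2_eq_square)
    next
      case (Suc l)
      then show ?thesis using d i k
        by (simp add: green_def min_def field_simps power2_eq_square)
    qed
  next
    case 2
    show ?thesis
    proof (cases n)
      case 0
      let ?J = "jost_quot a k 0"
      have "(k + 1 / k) * (?J * k) = ?J * k * k + ?J"
        using k by (simp add: distrib_left distrib_right mult_ac del: jost_quot.simps)
      moreover have "?J * (1 - a * k) = 1" using ak by simp
      ultimately show ?thesis using 0 2 i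
        by (simp add: green_def algebra_simps del: jost_quot.simps)
    next
      case (Suc l)
      then show ?thesis using 2 i k
        by (simp add: green_def min_def field_simps power2_eq_square)
    qed
  next
    case 3
    then obtain d where d: "n = Suc (i + d)" by (metis less_iff_Suc_add)
    show ?thesis using d i k
      by (cases d) (simp_all add: green_def min_def field_simps power2_eq_square Suc_diff_le)
  qed
qed

section \<open>Green's identity and the representation formula on finite sections\<close>

text \<open>By symmetry of the Jacobi matrix the mixed products telescope. A Wronskian remains at
  \<open>N\<close>; the one at the other end is removed by the zeros at index 0.\<close>

lemma green_identity:
  fixes G f b :: "nat \<Rightarrow> 'a::comm_ring_1"
  assumes "G 0 = 0" and "f 0 = 0"
  shows "(\<Sum>n<N. G (Suc n) * (f n + f (Suc (Suc n)) + b n * f (Suc n)))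
         = (\<Sum>n<N. f (Suc n) * (G n + G (Suc (Suc n)) + b n * G (Suc n)))
           + (G N * f (Suc N) - G (Suc N) * f N)"
  by (induction N) (simp_all add: assms algebra_simps)

lemma green_representation_finite:
  fixes a k :: "'a::field" and f :: "nat \<Rightarrow> 'a"
  assumes "k \<noteq> 0" and "a * k \<noteq> 1" and m: "1 \<le> m" "m \<le> N" and "f 0 = 0"
  shows "(\<Sum>n<N. green a k m (Suc n) *
            (f n + f (Suc (Suc n)) + ((if n = 0 then a else 0) - (k + 1 / k)) * f (Suc n)))
         = - f m + (green a k m N * f (Suc N) - green a k m (Suc N) * f N)"
proof -
  have "(\<Sum>n<N. f (Suc n) * (if Suc n = m then - 1 else 0)) = (\<Sum>n\<in>{m - 1}. - f (Suc n))"
    using m by (intro sum.mono_neutral_cong_right) auto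
  also have "\<dots> = - f m" using m by simp
  finally show ?thesis
    using green_identity[of "green a k m" f "\<lambda>n. (if n = 0 then a else 0) - (k + 1 / k)" N] assms
    by (simp add: green_equation)
qed

section \<open>Bounds on the kernel\<close>

lemma one_le_jost_quot:
  fixes a :: real
  assumes "0 \<le> a" "a < 1"
  shows "1 \<le> jost_quot a 1 n"
  by (induction n) (use assms in auto)

lemma norm_jost_quot_0_le:
  fixes a :: real and k :: complex
  assumes "0 \<le> a" "a < 1" "cmod k \<le> 1"
  shows "cmod (jost_quot (of_real a) k 0) \<le> 1 / (1 - a)" and "of_real a * k \<noteq> 1"
proof -
  have "cmod (of_real a * k) \<le> a"
    using assms by (simp add: norm_mult mult_left_le)
  moreover have "1 \<le> cmod (1 - of_real a * k) + cmod (of_real a * k)"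
    using norm_triangle_ineq[of "1 - of_real a * k" "of_real a * k"] by simp
  ultimately have *: "1 - a \<le> cmod (1 - of_real a * k)" by linarith
  then show "cmod (jost_quot (of_real a) k 0) \<le> 1 / (1 - a)"
    using assms by (simp add: norm_divide frac_le)
  show "of_real a * k \<noteq> 1" using * assms by auto
qed

text \<open>The recursion has positive coefficients that grow with the modulus of \<open>k\<close>,
  so \<open>k = 1\<close> is the worst case. There \<open>jost_quot a 1 n\<close> equals
  \<open>n + 1 / (1 - a)\<close>: unbounded in \<open>n\<close>, but independent of the spectral
  parameter.\<close>

lemma norm_jost_quot_le:
  fixes a :: real and k :: complex
  assumes "0 \<le> a" "a < 1" "cmod k \<le> 1"
  shows "cmod (jost_quot (of_real a) k n) \<le> jost_quot a 1 n"
proof (induction n)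
  case 0
  then show ?case using norm_jost_quot_0_le[OF assms] by simp
next
  case (Suc n)
  have "cmod (k\<^sup>2 * jost_quot (of_real a) k n) \<le> 1 * jost_quot a 1 n"
    unfolding norm_mult norm_power
    by (intro mult_mono Suc power_le_one) (use assms in auto)
  then show ?case
    using norm_triangle_ineq[of 1 "k\<^sup>2 * jost_quot (of_real a) k n"] by simp
qed

lemma norm_green_le:
  fixes a :: real and k :: complex
  assumes "0 \<le> a" "a < 1" "cmod k \<le> 1"
  shows "cmod (green (of_real a) k m n) \<le> green a 1 m n"
proof -
  have "cmod (jost_quot (of_real a) k i * k ^ d) \<le> jost_quot a 1 i * 1" for i d
    unfolding norm_mult norm_power
    by (intro mult_mono norm_jost_quot_le power_le_one)
      (use assms one_le_jost_quot[of a i] in auto)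
  then show ?thesis by (simp add: green_def del: power_Suc)
qed

text \<open>With \<open>r = (cmod k)\<^sup>2\<close>, the bound \<open>P\<close> satisfies
  \<open>1 + r * P \<le> P\<close>, so the recursion cannot leave it.\<close>

lemma norm_jost_quot_le_uniform:
  fixes a :: real and k :: complex
  assumes "0 \<le> a" "a < 1" "cmod k < 1"
  shows "cmod (jost_quot (of_real a) k n) \<le> 1 / (1 - a) + 1 / (1 - (cmod k)\<^sup>2)"
proof (induction n)
  case 0
  have "0 \<le> 1 / (1 - (cmod k)\<^sup>2)" using assms by (simp add: power_le_one)
  then show ?case using norm_jost_quot_0_le(1)[of a k] assms by linarith
next
  case (Suc n)
  let ?r = "(cmod k)\<^sup>2" and ?P = "1 / (1 - a) + 1 / (1 - (cmod k)\<^sup>2)"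
  have r: "?r < 1" "0 \<le> ?r" using assms by (auto simp: abs_square_less_1)
  have "cmod (jost_quot (of_real a) k (Suc n)) \<le> 1 + ?r * cmod (jost_quot (of_real a) k n)"
    using norm_triangle_ineq[of 1 "k\<^sup>2 * jost_quot (of_real a) k n"] by (simp add: norm_mult norm_power)
  also have "\<dots> \<le> 1 + ?r * ?P" by (intro add_left_mono mult_left_mono Suc) simp
  also have "\<dots> \<le> ?P"
  proof -
    have "(1 - ?r) * ?P = (1 - ?r) / (1 - a) + 1" using r by (simp add: distrib_left)
    also have "\<dots> \<ge> 1" using r assms by simp
    finally show ?thesis by (simp only: left_diff_distrib mult_1_left le_diff_eq add.commute)
  qed
  finally show ?case .
qed

subsection \<open>The Hardy weight\<close>

text \<open>This is the identity (2 - J) g = \<rho> g for g = n^q, read at the site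
  \<open>n + 1\<close>. At the first site \<open>real 0 powr q = 0\<close> supplies the missing left
  neighbour.\<close>

lemma hardy_weight_mult_powr:
  fixes q :: real
  assumes q: "0 < q"
  shows "hardy_weight a q (Suc n) * real (Suc n) powr q
       = 2 * real (Suc n) powr q - real n powr q - real (Suc (Suc n)) powr q
           - (if n = 0 then a else 0) * real (Suc n) powr q"
proof -
  have "(1 - 1 / real (Suc n)) powr q * real (Suc n) powr q = ((1 - 1 / real (Suc n)) * real (Suc n)) powr q"
    by (subst powr_mult) auto
  moreover have "(1 - 1 / real (Suc n)) * real (Suc n) = real n" by (simp add: field_simps)
  moreover have "(1 + 1 / real (Suc n)) powr q * real (Suc n) powr q = ((1 + 1 / real (Suc n)) * real (Suc n)) powr q"
    by (subst powr_mult) auto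
  moreover have "(1 + 1 / real (Suc n)) * real (Suc n) = real (Suc (Suc n))" by (simp add: field_simps)
  ultimately show ?thesis unfolding hardy_weight_def by (simp add: left_diff_distrib)
qed

text \<open>Bernoulli's inequality as a weighted AM-GM of \<open>1 + x\<close> and 1; at
  \<open>x = -1\<close> the left side is 0.\<close>

lemma powr_le_one_plus:
  fixes x p :: real
  assumes "-1 \<le> x" "0 \<le> p" "p \<le> 1"
  shows "(1 + x) powr p \<le> 1 + p * x"
proof (cases "x = -1")
  case True
  then show ?thesis using assms by simp
next
  case False
  with assms have x: "0 < 1 + x" by simp
  then have "(1 + x) powr p * 1 powr (1 - p) \<le> p * (1 + x) + (1 - p) * 1"
    using Youngs_inequality_0[of p "1 - p" "1 + x" 1] assms by simp
  then show ?thesis by (simp add: algebra_simps)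
qed

text \<open>Bernoulli with exponent \<open>2 * q \<le> 1\<close> bounds the sum of the squares of
  the two powers by 2. They are distinct, so the parallelogram law makes their sum strictly less
  than 2.\<close>

lemma hardy_weight_pos:
  assumes q: "0 < q" "q \<le> 1 / 2" and n: "n \<ge> 2"
  shows "0 < hardy_weight a q n"
proof -
  let ?x = "1 / real n"
  let ?A = "(1 + ?x) powr q" and ?B = "(1 - ?x) powr q"
  have x: "0 < ?x" "?x < 1" using n by auto
  have "?A\<^sup>2 = (1 + ?x) powr (2 * q)" "?B\<^sup>2 = (1 - ?x) powr (2 * q)"
    using x by (simp_all add: power2_eq_square flip: powr_add)
  moreover have "(1 + ?x) powr (2 * q) \<le> 1 + (2 * q) * ?x" "(1 + - ?x) powr (2 * q) \<le> 1 + (2 * q) * - ?x"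
    using x q by (intro powr_le_one_plus; linarith)+
  ultimately have AB: "?A\<^sup>2 + ?B\<^sup>2 \<le> 2" by simp
  have "?B < ?A" using x q by (intro powr_less_mono2) auto
  then have "0 < (?A - ?B)\<^sup>2" by simp
  moreover have "p < 4" if "0 < w" "p = 2 * s - w" "s \<le> 2" for p s w :: real
    using that by linarith
  moreover have "(?A + ?B)\<^sup>2 = 2 * (?A\<^sup>2 + ?B\<^sup>2) - (?A - ?B)\<^sup>2" by (simp add: power2_eq_square algebra_simps)
  ultimately have "(?A + ?B)\<^sup>2 < 4" using AB by blast
  then have "(?A + ?B)\<^sup>2 < 2\<^sup>2" by simp
  then have "?A + ?B < 2" by (rule power_less_imp_less_base) simp
  then show ?thesis using n by (simp add: hardy_weight_def)
qed

lemma hardy_weight_nonneg: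
  assumes "a < 1" "0 < q" "q \<le> min (log 2 (2 - a)) (1 / 2)" and n: "n \<ge> 1"
  shows "0 \<le> hardy_weight a q n"
proof (cases "n = 1")
  case True
  \<comment> \<open>At the first site the weight is \<open>2 - a - 2 powr q\<close>; this is where
    the logarithmic bound on \<open>q\<close> enters.\<close>
  have "2 powr q \<le> 2 powr (log 2 (2 - a))" using assms by (intro powr_mono) auto
  also have "\<dots> = 2 - a" using assms by simp
  finally show ?thesis using True by (simp add: hardy_weight_def)
next
  case False
  then show ?thesis using hardy_weight_pos[of q n a] assms by auto
qed

section \<open>The Hardy inequality for the kernel at k = 1\<close>

locale hardy =
  fixes a q :: real
  assumes a: "0 \<le> a" "a < 1" and q: "0 < q" "q \<le> min (log 2 (2 - a)) (1 / 2)"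
begin

lemma weight_nonneg: "0 \<le> hardy_weight a q (Suc n)"
  using hardy_weight_nonneg[of a q "Suc n"] a q by simp

lemma green_ge_one: "1 \<le> green a 1 m (Suc n)"
  using one_le_jost_quot[OF a] by (simp add: green_def)

text \<open>Representing g = n^q by the kernel at \<open>k = 1\<close> turns the sum into g at
  \<open>m\<close> minus a boundary term. That term is nonnegative, because the kernel is constant
  beyond \<open>m\<close> and g increases.\<close>

lemma green_hardy_sum_le:
  assumes m: "m \<ge> 1"
  shows "(\<Sum>n<N. green a 1 m (Suc n) * (hardy_weight a q (Suc n) * real (Suc n) powr q)) \<le> real m powr q"
    (is "sum ?t _ \<le> _")
proof -
  have nn: "0 \<le> ?t n" for n
    using green_ge_one[of m n] weight_nonneg[of n] by simp
  \<comment> \<open>The section must reach \<open>m\<close> for the representation to apply; the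
    added terms are nonnegative.\<close>
  let ?M = "m + N" and ?g = "\<lambda>n. real n powr q"
  have "sum ?t {..<N} \<le> sum ?t {..<?M}"
    by (intro sum_mono2 nn) auto
  also have "\<dots> = - (\<Sum>n<?M. green a 1 m (Suc n) *
      (?g n + ?g (Suc (Suc n)) + ((if n = 0 then a else 0) - (1 + 1 / 1)) * ?g (Suc n)))"
    unfolding sum_negf[symmetric] hardy_weight_mult_powr[OF q(1)]
    by (intro sum.cong refl) (simp add: algebra_simps)
  also have "\<dots> = ?g m - (green a 1 m ?M * ?g (Suc ?M) - green a 1 m (Suc ?M) * ?g ?M)"
    using a m q by (subst green_representation_finite) auto
  also have "green a 1 m (Suc ?M) = green a 1 m ?M"
    using m by (simp add: green_def)
  also have "?g m - (green a 1 m ?M * ?g (Suc ?M) - green a 1 m ?M * ?g ?M)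
      = ?g m - green a 1 m ?M * (?g (Suc ?M) - ?g ?M)" by (simp add: algebra_simps)
  also have "\<dots> \<le> ?g m"
  proof -
    have "?g ?M \<le> ?g (Suc ?M)" using q by (intro powr_mono2) auto
    moreover have "0 \<le> green a 1 m ?M" using green_ge_one[of m "?M - 1"] m by simp
    ultimately show ?thesis by simp
  qed
  finally show ?thesis .
qed

lemma green_hardy_summable:
  assumes m: "m \<ge> 1"
  shows "summable (\<lambda>n. green a 1 m (Suc n) * (hardy_weight a q (Suc n) * real (Suc n) powr q))"
proof (rule bounded_imp_summable)
  show "0 \<le> green a 1 m (Suc n) * (hardy_weight a q (Suc n) * real (Suc n) powr q)" for n
    using green_ge_one[of m n] weight_nonneg[of n] by simp
  show "(\<Sum>n\<le>N. green a 1 m (Suc n) * (hardy_weight a q (Suc n) * real (Suc n) powr q))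
      \<le> real m powr q" for N
    using green_hardy_sum_le[OF m, of "Suc N"] unfolding lessThan_Suc_atMost .
qed

lemma one_le_powr: "1 \<le> real (Suc n) powr q"
  using q ge_one_powr_ge_zero[of "real (Suc n)" q] by simp

text \<open>All kernel entries are at least 1, so the Hardy sum at \<open>m = 1\<close> is a
  majorant. Hence multiplication by the potential sends sequences of size O(n^q) into
  \<open>ell2\<close>.\<close>

lemma summable_hardy_weight_powr: "summable (\<lambda>n. hardy_weight a q (Suc n) * real (Suc n) powr q)"
proof (rule summable_comparison_test'[OF green_hardy_summable[of 1]])
  fix n
  have "1 * (hardy_weight a q (Suc n) * real (Suc n) powr q)
      \<le> green a 1 1 (Suc n) * (hardy_weight a q (Suc n) * real (Suc n) powr q)"
    using weight_nonneg green_ge_one by (intro mult_right_mono) auto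
  then show "norm (hardy_weight a q (Suc n) * real (Suc n) powr q)
      \<le> green a 1 1 (Suc n) * (hardy_weight a q (Suc n) * real (Suc n) powr q)"
    using weight_nonneg[of n] by simp
qed simp

end

subsection \<open>Square-summable sequences\<close>

lemma ell2_summable: "\<psi> \<in> ell2 \<Longrightarrow> summable (\<lambda>n. (cmod (\<psi> n))\<^sup>2)"
  and ell2_0: "\<psi> \<in> ell2 \<Longrightarrow> \<psi> 0 = 0"
  by (simp_all add: ell2_def)

lemma l2norm_power2: "\<psi> \<in> ell2 \<Longrightarrow> (l2norm \<psi>)\<^sup>2 = (\<Sum>n. (cmod (\<psi> n))\<^sup>2)"
  by (simp add: l2norm_def ell2_summable suminf_nonneg)

lemma l2norm_nonneg: "\<psi> \<in> ell2 \<Longrightarrow> 0 \<le> l2norm \<psi>"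
  by (simp add: l2norm_def ell2_summable suminf_nonneg)

lemma L2_set_le_l2norm:
  assumes "\<psi> \<in> ell2"
  shows "L2_set (\<lambda>n. cmod (\<psi> n)) {..<N} \<le> l2norm \<psi>"
  unfolding L2_set_def l2norm_def
  by (intro real_sqrt_le_mono sum_le_suminf ell2_summable assms) auto

lemma ell2_boundI:
  assumes "\<psi> 0 = 0" and B: "\<And>N. L2_set (\<lambda>n. cmod (\<psi> n)) {..<N} \<le> B"
  shows "\<psi> \<in> ell2" and "l2norm \<psi> \<le> B"
proof -
  have B0: "0 \<le> B" using B[of 0] by simp
  have le: "(\<Sum>n<N. (cmod (\<psi> n))\<^sup>2) \<le> B\<^sup>2" for N
    using B[of N] B0 unfolding L2_set_def by (metis real_le_lsqrt real_sqrt_le_iff real_sqrt_unique)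
  have s: "summable (\<lambda>n. (cmod (\<psi> n))\<^sup>2)"
    using le[of "Suc _"] by (intro bounded_imp_summable[where B = "B\<^sup>2"]) (auto simp: lessThan_Suc_atMost)
  then show "\<psi> \<in> ell2" using assms by (simp add: ell2_def)
  show "l2norm \<psi> \<le> B"
    unfolding l2norm_def using suminf_le_const[OF s le] B0 by (simp add: real_le_lsqrt)
qed

lemma norm_le_l2norm:
  assumes "\<psi> \<in> ell2"
  shows "cmod (\<psi> n) \<le> l2norm \<psi>"
proof -
  have "cmod (\<psi> n) \<le> L2_set (\<lambda>n. cmod (\<psi> n)) {..<Suc n}"
    by (rule member_le_L2_set) auto
  then show ?thesis using L2_set_le_l2norm[OF assms] order_trans by blast
qed

lemma ell2_tendsto_0:
  assumes "\<psi> \<in> ell2"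
  shows "\<psi> \<longlonglongrightarrow> 0"
proof -
  have "(\<lambda>n. sqrt ((cmod (\<psi> n))\<^sup>2)) \<longlonglongrightarrow> sqrt 0"
    by (intro tendsto_real_sqrt summable_LIMSEQ_zero ell2_summable assms)
  then show ?thesis by (simp add: tendsto_norm_zero_iff)
qed

lemma
  assumes "\<phi> \<in> ell2" "\<psi> \<in> ell2"
  shows ell2_add: "(\<lambda>n. \<phi> n + \<psi> n) \<in> ell2"
    and l2norm_triangle: "l2norm (\<lambda>n. \<phi> n + \<psi> n) \<le> l2norm \<phi> + l2norm \<psi>"
proof -
  have le: "L2_set (\<lambda>n. cmod (\<phi> n + \<psi> n)) {..<N} \<le> l2norm \<phi> + l2norm \<psi>" for N
  proof -
    have "L2_set (\<lambda>n. cmod (\<phi> n + \<psi> n)) {..<N} \<le> L2_set (\<lambda>n. cmod (\<phi> n) + cmod (\<psi> n)) {..<N}"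
      by (intro L2_set_mono norm_triangle_ineq) auto
    also have "\<dots> \<le> L2_set (\<lambda>n. cmod (\<phi> n)) {..<N} + L2_set (\<lambda>n. cmod (\<psi> n)) {..<N}"
      by (rule L2_set_triangle_ineq)
    also have "\<dots> \<le> l2norm \<phi> + l2norm \<psi>"
      by (intro add_mono L2_set_le_l2norm assms)
    finally show ?thesis .
  qed
  have "\<phi> 0 + \<psi> 0 = 0" using assms by (simp add: ell2_0)
  then show "(\<lambda>n. \<phi> n + \<psi> n) \<in> ell2" "l2norm (\<lambda>n. \<phi> n + \<psi> n) \<le> l2norm \<phi> + l2norm \<psi>"
    using ell2_boundI[where \<psi> = "\<lambda>n. \<phi> n + \<psi> n", OF _ le] by auto
qed

lemma
  assumes "\<psi> \<in> ell2" "h 0 = 0" "0 \<le> B" and h: "\<And>n. cmod (h (Suc n)) \<le> B * cmod (\<psi> (Suc n))"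
  shows ell2_dominated: "h \<in> ell2" and l2norm_dominated: "l2norm h \<le> B * l2norm \<psi>"
proof -
  have h': "cmod (h n) \<le> B * cmod (\<psi> n)" for n
    using h assms ell2_0[OF assms(1)] by (cases n) auto
  have "L2_set (\<lambda>n. cmod (h n)) {..<N} \<le> B * l2norm \<psi>" for N
  proof -
    have "L2_set (\<lambda>n. cmod (h n)) {..<N} \<le> L2_set (\<lambda>n. B * cmod (\<psi> n)) {..<N}"
      by (intro L2_set_mono h') auto
    also have "\<dots> = B * L2_set (\<lambda>n. cmod (\<psi> n)) {..<N}"
      using assms by (simp add: L2_set_right_distrib)
    also have "\<dots> \<le> B * l2norm \<psi>" by (intro mult_left_mono L2_set_le_l2norm assms)
    finally show ?thesis .
  qed
  then show "h \<in> ell2" "l2norm h \<le> B * l2norm \<psi>"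
    using ell2_boundI[where \<psi> = h, OF assms(2)] by auto
qed

lemma ell2_scale: "\<psi> \<in> ell2 \<Longrightarrow> (\<lambda>n. c * \<psi> n) \<in> ell2"
  by (rule ell2_dominated[where B = "cmod c" and \<psi> = \<psi>]) (auto simp: ell2_0 norm_mult)

lemma l2norm_scale_le: "\<psi> \<in> ell2 \<Longrightarrow> l2norm (\<lambda>n. c * \<psi> n) \<le> cmod c * l2norm \<psi>"
  by (rule l2norm_dominated[where B = "cmod c" and \<psi> = \<psi>]) (auto simp: ell2_0 norm_mult)

lemma ell2_diff: "\<phi> \<in> ell2 \<Longrightarrow> \<psi> \<in> ell2 \<Longrightarrow> (\<lambda>n. \<phi> n - \<psi> n) \<in> ell2"
  using ell2_add[of \<phi> "\<lambda>n. (-1) * \<psi> n"] ell2_scale[of \<psi> "-1"] by simp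

lemma l2norm_triangle_diff:
  "\<phi> \<in> ell2 \<Longrightarrow> \<psi> \<in> ell2 \<Longrightarrow> l2norm (\<lambda>n. \<phi> n - \<psi> n) \<le> l2norm \<phi> + l2norm \<psi>"
  using l2norm_triangle[of \<phi> "\<lambda>n. (-1) * \<psi> n"] ell2_scale[of \<psi> "-1"] l2norm_scale_le[of \<psi> "-1"] by simp

lemma l2norm_triangle_sub:
  "\<phi> \<in> ell2 \<Longrightarrow> \<psi> \<in> ell2 \<Longrightarrow> l2norm \<phi> \<le> l2norm (\<lambda>n. \<phi> n - \<psi> n) + l2norm \<psi>"
  using l2norm_triangle[of "\<lambda>n. \<phi> n - \<psi> n" \<psi>] by (simp add: ell2_diff)

lemma l2norm_minus_commute: "l2norm (\<lambda>n. \<phi> n - \<psi> n) = l2norm (\<lambda>n. \<psi> n - \<phi> n)"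
  by (simp add: l2norm_def norm_minus_commute)

lemma
  assumes "\<psi> \<in> ell2"
  shows ell2_shift_right: "(\<lambda>n. \<psi> (n - 1)) \<in> ell2"
    and l2norm_shift_right: "l2norm (\<lambda>n. \<psi> (n - 1)) = l2norm \<psi>"
proof -
  have 1: "summable (\<lambda>n. (cmod (\<psi> (n - 1)))\<^sup>2)"
    using ell2_summable[OF assms] by (subst summable_Suc_iff[symmetric]) simp
  then show "(\<lambda>n. \<psi> (n - 1)) \<in> ell2" using assms by (simp add: ell2_def)
  show "l2norm (\<lambda>n. \<psi> (n - 1)) = l2norm \<psi>"
    using suminf_split_head[OF 1] ell2_0[OF assms] by (simp add: l2norm_def)
qed

lemma
  assumes "\<psi> \<in> ell2"
  shows ell2_shift_left: "(\<lambda>n. if n = 0 then 0 else \<psi> (Suc n)) \<in> ell2" (is "?L \<in> _")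
    and l2norm_shift_left: "l2norm (\<lambda>n. if n = 0 then 0 else \<psi> (Suc n)) \<le> l2norm \<psi>"
proof -
  have s: "summable (\<lambda>n. (cmod (\<psi> (Suc n)))\<^sup>2)"
    using ell2_summable[OF assms] by (subst summable_Suc_iff)
  have le: "(cmod (?L n))\<^sup>2 \<le> (cmod (\<psi> (Suc n)))\<^sup>2" for n by simp
  have L: "summable (\<lambda>n. (cmod (?L n))\<^sup>2)"
    by (rule summable_comparison_test'[OF s, of 0]) (use le in simp)
  then show "?L \<in> ell2" by (simp add: ell2_def)
  have "(\<Sum>n. (cmod (?L n))\<^sup>2) \<le> (\<Sum>n. (cmod (\<psi> (Suc n)))\<^sup>2)"
    by (intro suminf_le le L s)
  also have "\<dots> \<le> (\<Sum>n. (cmod (\<psi> n))\<^sup>2)"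
    using suminf_split_head[OF ell2_summable[OF assms]] by simp
  finally show "l2norm ?L \<le> l2norm \<psi>" unfolding l2norm_def by (rule real_sqrt_le_mono)
qed

section \<open>Completeness, projection and orthogonality\<close>

lemma l2norm_parallelogram:
  assumes "\<phi> \<in> ell2" "\<psi> \<in> ell2"
  shows "(l2norm (\<lambda>n. \<phi> n + \<psi> n))\<^sup>2 + (l2norm (\<lambda>n. \<phi> n - \<psi> n))\<^sup>2 = 2 * (l2norm \<phi>)\<^sup>2 + 2 * (l2norm \<psi>)\<^sup>2"
proof -
  have pl: "(cmod (x + y))\<^sup>2 + (cmod (x - y))\<^sup>2 = 2 * (cmod x)\<^sup>2 + 2 * (cmod y)\<^sup>2" for x y
    unfolding cmod_power2 by (simp add: power2_eq_square algebra_simps)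
  show ?thesis
    using assms
    by (simp add: l2norm_power2 ell2_add ell2_diff suminf_add suminf_mult[symmetric] ell2_summable
        summable_mult pl)
qed

text \<open>The norm of each finite section passes to the coordinatewise limit, so the bound
  survives section by section.\<close>

lemma
  assumes f: "\<And>j. f j \<in> ell2" and lim: "\<And>n. (\<lambda>j. f j n) \<longlonglongrightarrow> r n"
    and B: "\<forall>\<^sub>F j in sequentially. l2norm (f j) \<le> B"
  shows ell2_fatou: "r \<in> ell2" and l2norm_fatou: "l2norm r \<le> B"
proof -
  have "(\<lambda>j. f j 0) \<longlonglongrightarrow> 0" by (simp add: ell2_0[OF f])
  then have r0: "r 0 = 0" using lim[of 0] LIMSEQ_unique by blast
  have "L2_set (\<lambda>n. cmod (r n)) {..<N} \<le> B" for N
  proof (rule tendsto_upperbound)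
    show "(\<lambda>j. L2_set (\<lambda>n. cmod (f j n)) {..<N}) \<longlonglongrightarrow> L2_set (\<lambda>n. cmod (r n)) {..<N}"
      unfolding L2_set_def by (intro tendsto_intros lim)
    show "\<forall>\<^sub>F j in sequentially. L2_set (\<lambda>n. cmod (f j n)) {..<N} \<le> B"
      using B by eventually_elim (use L2_set_le_l2norm[OF f] order_trans in blast)
  qed simp
  then show "r \<in> ell2" "l2norm r \<le> B" using ell2_boundI[where \<psi> = r, OF r0] by auto
qed

lemma ell2_complete:
  assumes f: "\<And>j. f j \<in> ell2"
    and C: "\<And>\<epsilon>. \<epsilon> > 0 \<Longrightarrow> \<exists>M. \<forall>i\<ge>M. \<forall>j\<ge>M. l2norm (\<lambda>n. f i n - f j n) < \<epsilon>"
  obtains r where "r \<in> ell2" "\<And>n. (\<lambda>j. f j n) \<longlonglongrightarrow> r n" "(\<lambda>j. l2norm (\<lambda>n. f j n - r n)) \<longlonglongrightarrow> 0"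
proof -
  have "Cauchy (\<lambda>j. f j n)" for n
  proof (rule CauchyI)
    fix e :: real assume "0 < e"
    then obtain M where M: "\<forall>i\<ge>M. \<forall>j\<ge>M. l2norm (\<lambda>n. f i n - f j n) < e" using C by blast
    have "norm (f i n - f j n) < e" if "i \<ge> M" "j \<ge> M" for i j
      using norm_le_l2norm[OF ell2_diff[OF f[of i] f[of j]], of n] M that le_less_trans by blast
    then show "\<exists>M. \<forall>i\<ge>M. \<forall>j\<ge>M. norm (f i n - f j n) < e" by blast
  qed
  then have "\<exists>x. (\<lambda>j. f j n) \<longlonglongrightarrow> x" for n
    using Cauchy_convergent convergent_def by blast
  then obtain r where r: "\<And>n. (\<lambda>j. f j n) \<longlonglongrightarrow> r n" by metis
  have le: "\<exists>M. \<forall>i\<ge>M. (\<lambda>n. f i n - r n) \<in> ell2 \<and> l2norm (\<lambda>n. f i n - r n) \<le> \<epsilon>" if "\<epsilon> > 0" for \<epsilon>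
  proof -
    obtain M where M: "\<forall>i\<ge>M. \<forall>j\<ge>M. l2norm (\<lambda>n. f i n - f j n) < \<epsilon>" using C \<open>\<epsilon> > 0\<close> by blast
    have "(\<lambda>n. f i n - r n) \<in> ell2 \<and> l2norm (\<lambda>n. f i n - r n) \<le> \<epsilon>" if "i \<ge> M" for i
    proof -
      have ev: "\<forall>\<^sub>F j in sequentially. l2norm (\<lambda>n. f i n - f j n) \<le> \<epsilon>"
        using M that by (auto simp: eventually_sequentially intro!: exI[of _ M] less_imp_le)
      have "(\<lambda>j. f i n - f j n) \<longlonglongrightarrow> f i n - r n" for n by (intro tendsto_intros r)
      from ell2_fatou[OF ell2_diff[OF f f] this ev] l2norm_fatou[OF ell2_diff[OF f f] this ev]
      show ?thesis by blast
    qed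
    then show ?thesis by blast
  qed
  obtain M where M: "(\<lambda>n. f M n - r n) \<in> ell2" using le[of 1] by auto
  have rl: "r \<in> ell2" using ell2_diff[OF f[of M] M] by simp
  have "(\<lambda>j. l2norm (\<lambda>n. f j n - r n)) \<longlonglongrightarrow> 0"
  proof (rule LIMSEQ_I)
    fix \<epsilon> :: real assume "\<epsilon> > 0"
    then obtain M where "\<forall>i\<ge>M. (\<lambda>n. f i n - r n) \<in> ell2 \<and> l2norm (\<lambda>n. f i n - r n) \<le> \<epsilon> / 2"
      using le[of "\<epsilon> / 2"] by auto
    then show "\<exists>no. \<forall>j\<ge>no. norm (l2norm (\<lambda>n. f j n - r n) - 0) < \<epsilon>"
      using \<open>\<epsilon> > 0\<close> l2norm_nonneg by (intro exI[of _ M]) fastforce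
  qed
  with rl r that show thesis by blast
qed

text \<open>Projection onto the closure of \<open>R\<close> without an inner product: orthogonality
  of \<open>r\<close> to \<open>R\<close> is expressed as 0 being a nearest point of
  \<open>R\<close> to \<open>r\<close>. The residuals of a minimizing sequence converge to such an
  \<open>r\<close>; since \<open>orth\<close> forces \<open>r\<close> to vanish, the distance is
  0.\<close>

lemma dense_subspace_criterion:
  assumes R: "R \<subseteq> ell2" "(\<lambda>_. 0) \<in> R"
    and add: "\<And>x y. x \<in> R \<Longrightarrow> y \<in> R \<Longrightarrow> (\<lambda>n. x n + y n) \<in> R"
    and scale: "\<And>x c. x \<in> R \<Longrightarrow> (\<lambda>n. c * x n) \<in> R"
    and orth: "\<And>r. r \<in> ell2 \<Longrightarrow> (\<And>w. w \<in> R \<Longrightarrow> l2norm r \<le> l2norm (\<lambda>n. r n - w n)) \<Longrightarrow> r = (\<lambda>_. 0)"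
    and \<phi>: "\<phi> \<in> ell2" and "\<epsilon> > 0"
  shows "\<exists>w\<in>R. l2norm (\<lambda>n. \<phi> n - w n) < \<epsilon>"
proof -
  define D where "D = (\<lambda>w. l2norm (\<lambda>n. \<phi> n - w n)) ` R"
  define d where "d = Inf D"
  have bd: "bdd_below D"
    unfolding D_def using R \<phi> by (intro bdd_belowI2[of _ 0] l2norm_nonneg ell2_diff) auto
  have ne: "D \<noteq> {}" unfolding D_def using R by auto
  have d_le: "d \<le> l2norm (\<lambda>n. \<phi> n - w n)" if "w \<in> R" for w
    unfolding d_def by (rule cInf_lower[OF _ bd]) (use that in \<open>auto simp: D_def\<close>)
  have d0: "0 \<le> d" unfolding d_def
    using R \<phi> by (intro cInf_greatest[OF ne]) (auto simp: D_def intro!: l2norm_nonneg ell2_diff)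
  have "\<exists>w\<in>R. l2norm (\<lambda>n. \<phi> n - w n) < d + 1 / real (Suc j)" for j
  proof -
    have "Inf D < d + 1 / real (Suc j)" by (simp add: d_def)
    from cInf_lessD[OF ne this] show ?thesis by (auto simp: D_def)
  qed
  then obtain w where w: "\<And>j. w j \<in> R" "\<And>j. l2norm (\<lambda>n. \<phi> n - w j n) < d + 1 / real (Suc j)"
    by metis
  define f where "f = (\<lambda>j n. \<phi> n - w j n)"
  have f: "f j \<in> ell2" for j unfolding f_def using w R \<phi> ell2_diff by blast
  have fd: "(\<lambda>j. l2norm (f j)) \<longlonglongrightarrow> d"
  proof (rule tendsto_sandwich)
    show "\<forall>\<^sub>F j in sequentially. d \<le> l2norm (f j)" "\<forall>\<^sub>F j in sequentially. l2norm (f j) \<le> d + 1 / real (Suc j)"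
      using w d_le by (auto simp: f_def intro!: always_eventually less_imp_le)
    show "(\<lambda>j. d + 1 / real (Suc j)) \<longlonglongrightarrow> d"
      using tendsto_add[OF tendsto_const LIMSEQ_inverse_real_of_nat, of d] by (simp add: inverse_eq_divide)
  qed simp
  \<comment> \<open>Midpoints of approximants lie in \<open>R\<close>, so half the sum of two
    residuals has norm at least \<open>d\<close>; the parallelogram law then makes their difference
    small.\<close>
  have par: "(l2norm (\<lambda>n. f i n - f j n))\<^sup>2 \<le> 2 * ((l2norm (f i))\<^sup>2 - d\<^sup>2) + 2 * ((l2norm (f j))\<^sup>2 - d\<^sup>2)" for i j
  proof -
    have "(\<lambda>n. (1/2) * (w i n + w j n)) \<in> R" using add scale w by blast
    then have "d \<le> l2norm (\<lambda>n. \<phi> n - (1/2) * (w i n + w j n))" by (rule d_le)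
    also have "(\<lambda>n. \<phi> n - (1/2) * (w i n + w j n)) = (\<lambda>n. (1/2) * (f i n + f j n))"
      by (simp add: f_def field_simps)
    also have "l2norm \<dots> \<le> 1 / 2 * l2norm (\<lambda>n. f i n + f j n)"
      using l2norm_scale_le[OF ell2_add[OF f f], of "1/2"] by (simp add: norm_divide)
    finally have "(2 * d)\<^sup>2 \<le> (l2norm (\<lambda>n. f i n + f j n))\<^sup>2"
      using d0 by (intro power_mono) auto
    then show ?thesis using l2norm_parallelogram[OF f f, of i j] by (simp add: power_mult_distrib)
  qed
  obtain r where r: "r \<in> ell2" and lim: "(\<lambda>j. l2norm (\<lambda>n. f j n - r n)) \<longlonglongrightarrow> 0"
  proof (rule ell2_complete[of f, OF f])
    fix \<epsilon> :: real assume "\<epsilon> > 0"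
    have "(\<lambda>j. (l2norm (f j))\<^sup>2 - d\<^sup>2) \<longlonglongrightarrow> d\<^sup>2 - d\<^sup>2" by (intro tendsto_intros fd)
    then have "\<forall>\<^sub>F j in sequentially. (l2norm (f j))\<^sup>2 - d\<^sup>2 < \<epsilon>\<^sup>2 / 4"
      using \<open>\<epsilon> > 0\<close> by (intro order_tendstoD) auto
    then obtain M where M: "\<And>j. j \<ge> M \<Longrightarrow> (l2norm (f j))\<^sup>2 - d\<^sup>2 < \<epsilon>\<^sup>2 / 4"
      by (auto simp: eventually_sequentially)
    have "l2norm (\<lambda>n. f i n - f j n) < \<epsilon>" if "i \<ge> M" "j \<ge> M" for i j
    proof (rule power_less_imp_less_base)
      have "y < x" if "s < x / 4" "t < x / 4" "y \<le> 2 * s + 2 * t" for s t x y :: real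
        using that by simp
      from this[OF M[OF that(1)] M[OF that(2)] par]
      show "(l2norm (\<lambda>n. f i n - f j n))\<^sup>2 < \<epsilon>\<^sup>2" .
    qed (use \<open>\<epsilon> > 0\<close> in simp)
    then show "\<exists>M. \<forall>i\<ge>M. \<forall>j\<ge>M. l2norm (\<lambda>n. f i n - f j n) < \<epsilon>" by blast
  qed blast
  have rd: "l2norm r \<le> d"
  proof (rule tendsto_lowerbound)
    show "(\<lambda>j. l2norm (f j) + l2norm (\<lambda>n. f j n - r n)) \<longlonglongrightarrow> d"
      using tendsto_add[OF fd lim] by simp
    show "\<forall>\<^sub>F j in sequentially. l2norm r \<le> l2norm (f j) + l2norm (\<lambda>n. f j n - r n)"
      using l2norm_triangle_sub[OF r f] l2norm_minus_commute[of r]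
      by (intro always_eventually) (simp add: add.commute)
  qed simp
  have "r = (\<lambda>_. 0)"
  proof (rule orth[OF r])
    fix u assume u: "u \<in> R"
    \<comment> \<open>\<open>r - u\<close> is the limit of the differences between
      \<open>\<phi>\<close> and the elements \<open>w j + u\<close> of \<open>R\<close>.\<close>
    have "d \<le> l2norm (\<lambda>n. r n - u n)"
    proof (rule tendsto_lowerbound)
      show "(\<lambda>j. l2norm (\<lambda>n. f j n - r n) + l2norm (\<lambda>n. r n - u n)) \<longlonglongrightarrow> l2norm (\<lambda>n. r n - u n)"
        using tendsto_add[OF lim tendsto_const] by simp
      have "d \<le> l2norm (\<lambda>n. f j n - r n) + l2norm (\<lambda>n. r n - u n)" for j
      proof -
        have "d \<le> l2norm (\<lambda>n. \<phi> n - (w j n + u n))" by (intro d_le add w u)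
        also have "(\<lambda>n. \<phi> n - (w j n + u n)) = (\<lambda>n. (f j n - r n) + (r n - u n))"
          by (simp add: f_def algebra_simps)
        also have "l2norm \<dots> \<le> l2norm (\<lambda>n. f j n - r n) + l2norm (\<lambda>n. r n - u n)"
          using u R by (intro l2norm_triangle ell2_diff f r) auto
        finally show ?thesis .
      qed
      then show "\<forall>\<^sub>F j in sequentially. d \<le> l2norm (\<lambda>n. f j n - r n) + l2norm (\<lambda>n. r n - u n)" by simp
    qed simp
    then show "l2norm r \<le> l2norm (\<lambda>n. r n - u n)" using rd by simp
  qed
  then have "(\<lambda>j. l2norm (f j)) \<longlonglongrightarrow> 0" using lim by simp
  then have "\<forall>\<^sub>F j in sequentially. l2norm (f j) < \<epsilon>" using \<open>\<epsilon> > 0\<close> by (rule order_tendstoD)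
  then obtain j where "l2norm (f j) < \<epsilon>" by (auto simp: eventually_sequentially)
  then show ?thesis using w(1)[of j] by (auto simp: f_def)
qed

text \<open>First variation of the squared norm along \<open>w\<close>. The finite support of
  \<open>w\<close> makes the tails cancel, so that only finite sums are expanded.\<close>

lemma orthogonal_of_minimal:
  assumes r: "r \<in> ell2" and w: "w \<in> ell2" "\<And>n. n \<ge> K \<Longrightarrow> w n = 0"
    and min: "\<And>t. l2norm r \<le> l2norm (\<lambda>n. r n - t * w n)"
  shows "(\<Sum>n<K. cnj (w n) * r n) = 0"
proof -
  let ?s = "\<Sum>n<K. cnj (w n) * r n" and ?W = "\<Sum>n<K. (cmod (w n))\<^sup>2"
  \<comment> \<open>The optimal multiplier would be \<open>?s / ?W\<close>. Adding 1 keeps the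
    denominator positive when \<open>w\<close> vanishes, and the squared norm still drops by at
    least \<open>(cmod ?s)\<^sup>2 / (?W + 1)\<close>.\<close>
  define t where "t = of_real (1 / (?W + 1)) * ?s"
  have W: "0 \<le> ?W" by (intro sum_nonneg) auto
  have split: "(l2norm \<psi>)\<^sup>2 = (\<Sum>n<K. (cmod (\<psi> n))\<^sup>2) + (\<Sum>n. (cmod (\<psi> (n + K)))\<^sup>2)" if "\<psi> \<in> ell2" for \<psi>
    using that suminf_split_initial_segment[OF ell2_summable[OF that], of K] by (simp add: l2norm_power2)
  have rw: "(\<lambda>n. r n - t * w n) \<in> ell2" by (intro ell2_diff ell2_scale r w)
  have ex: "(cmod (x - t * y))\<^sup>2 = (cmod x)\<^sup>2 - 2 * Re (cnj t * (cnj y * x)) + (cmod t)\<^sup>2 * (cmod y)\<^sup>2" for x y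
    unfolding cmod_power2 by (simp add: power2_eq_square algebra_simps)
  have "(l2norm r)\<^sup>2 \<le> (l2norm (\<lambda>n. r n - t * w n))\<^sup>2"
    using min l2norm_nonneg[OF r] by (intro power_mono)
  then have "(\<Sum>n<K. (cmod (r n))\<^sup>2) \<le> (\<Sum>n<K. (cmod (r n - t * w n))\<^sup>2)"
    unfolding split[OF r] split[OF rw] by (simp add: w)
  also have "\<dots> = (\<Sum>n<K. (cmod (r n))\<^sup>2) - 2 * Re (cnj t * ?s) + (cmod t)\<^sup>2 * ?W"
    unfolding ex by (simp add: sum.distrib sum_subtractf sum_distrib_left Re_sum del: times_complex.sel)
  also have "Re (cnj t * ?s) = (cmod ?s)\<^sup>2 / (?W + 1)"
  proof -
    have "Re (cnj (of_real c * s) * s) = (cmod s)\<^sup>2 * c" for c s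
      unfolding cmod_power2 by (simp add: power2_eq_square algebra_simps)
    from this[of "1 / (?W + 1)" ?s] show ?thesis unfolding t_def by simp
  qed
  also have "(cmod t)\<^sup>2 = (cmod ?s)\<^sup>2 / (?W + 1)\<^sup>2"
    unfolding t_def norm_mult norm_of_real using W by (simp add: power_mult_distrib power_divide)
  finally have "2 * ((cmod ?s)\<^sup>2 / (?W + 1)) \<le> (cmod ?s)\<^sup>2 / (?W + 1)\<^sup>2 * ?W" by simp
  also have "\<dots> = (cmod ?s)\<^sup>2 / (?W + 1) * (?W / (?W + 1))" by (simp add: power2_eq_square)
  also have "\<dots> \<le> (cmod ?s)\<^sup>2 / (?W + 1) * 1" using W by (intro mult_left_mono) auto
  finally have "(cmod ?s)\<^sup>2 / (?W + 1) \<le> 0" by simp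
  then have "(cmod ?s)\<^sup>2 \<le> 0" using W by (simp add: divide_le_0_iff)
  then show ?thesis by simp
qed

subsection \<open>Eigenvectors of the perturbed operator\<close>

lemma shiftop_JV_Suc:
  "shiftop (JV a v) z \<psi> (Suc n) =
     \<psi> n + \<psi> (Suc (Suc n)) + ((if n = 0 then of_real a else 0) - z) * \<psi> (Suc n) + v (Suc n) * \<psi> (Suc n)"
  by (simp add: shiftop_def JV_def algebra_simps)

lemma shiftop_JV_0: "shiftop (JV a v) z \<psi> 0 = - z * \<psi> 0"
  by (simp add: shiftop_def JV_def)

lemma shiftop_JV_add:
  "shiftop (JV a v) z (\<lambda>n. \<phi> n + \<psi> n) = (\<lambda>n. shiftop (JV a v) z \<phi> n + shiftop (JV a v) z \<psi> n)"
  by (rule ext) (simp add: shiftop_def JV_def algebra_simps)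

lemma shiftop_JV_scale: "shiftop (JV a v) z (\<lambda>n. c * \<psi> n) = (\<lambda>n. c * shiftop (JV a v) z \<psi> n)"
  by (rule ext) (simp add: shiftop_def JV_def algebra_simps)

lemma shiftop_JV_diff:
  "shiftop (JV a v) z (\<lambda>n. \<phi> n - \<psi> n) = (\<lambda>n. shiftop (JV a v) z \<phi> n - shiftop (JV a v) z \<psi> n)"
  using shiftop_JV_add[of a v z \<phi> "\<lambda>n. (-1) * \<psi> n"] unfolding shiftop_JV_scale by simp

lemma shiftop_JV_ell2:
  assumes \<psi>: "\<psi> \<in> ell2" and v: "\<And>n. cmod (v (Suc n)) \<le> B"
  shows "shiftop (JV a v) z \<psi> \<in> ell2"
proof -
  define h where "h = (\<lambda>n. if n = 0 then 0 else (of_real a * (if n = 1 then 1 else 0) + v n - z) * \<psi> n)"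
  have "0 \<le> B" using v[of 0] norm_ge_zero order_trans by blast
  have "h \<in> ell2"
  proof (rule ell2_dominated[OF \<psi>])
    fix n
    have "cmod (of_real a * (if Suc n = 1 then 1 else 0) + v (Suc n) - z)
        \<le> cmod (of_real a * (if Suc n = 1 then 1 else 0) + v (Suc n)) + cmod z"
      by (rule norm_triangle_ineq4)
    also have "\<dots> \<le> cmod (of_real a * (if Suc n = 1 then 1 else 0)) + cmod (v (Suc n)) + cmod z"
      by (intro add_right_mono norm_triangle_ineq)
    also have "\<dots> \<le> \<bar>a\<bar> + B + cmod z"
      using v[of n] by (intro add_mono) auto
    finally show "cmod (h (Suc n)) \<le> (\<bar>a\<bar> + B + cmod z) * cmod (\<psi> (Suc n))"
      unfolding h_def by (simp add: norm_mult mult_right_mono)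
  qed (use \<open>0 \<le> B\<close> in \<open>auto simp: h_def\<close>)
  then have "(\<lambda>n. (\<psi> (n - 1) + (if n = 0 then 0 else \<psi> (Suc n))) + h n) \<in> ell2"
    by (intro ell2_add ell2_shift_right ell2_shift_left \<psi>)
  also have "(\<lambda>n. (\<psi> (n - 1) + (if n = 0 then 0 else \<psi> (Suc n))) + h n) = shiftop (JV a v) z \<psi>"
    using ell2_0[OF \<psi>] by (auto simp: fun_eq_iff h_def shiftop_def JV_def algebra_simps)
  finally show ?thesis .
qed

text \<open>With the unilateral shifts \<open>S\<close> (right) and \<open>L\<close> (left),
  \<open>J\<^sub>0 - (k + 1 / k) = - (1 - k L) (1 - k S) / k\<close>.\<close>

lemma free_lower_bound:
  assumes k: "k \<noteq> 0" "cmod k < 1" and \<psi>: "\<psi> \<in> ell2"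
  shows "l2norm \<psi> \<le> 1 / (1 - cmod k)\<^sup>2 * l2norm (shiftop (JV 0 (\<lambda>_. 0)) (k + 1 / k) \<psi>)"
proof -
  define T where "T = shiftop (JV 0 (\<lambda>_. 0)) (k + 1 / k) \<psi>"
  \<comment> \<open>\<open>\<chi>\<close> is (1 - k S) applied to \<open>\<psi>\<close>. Neither
    shift increases the norm, so each of the two factors is bounded below by
    \<open>1 - cmod k\<close>.\<close>
  define \<chi> where "\<chi> = (\<lambda>n. \<psi> n - k * \<psi> (n - 1))"
  have T: "T \<in> ell2" unfolding T_def by (rule shiftop_JV_ell2[OF \<psi>, of _ 0]) simp
  have \<chi>: "\<chi> \<in> ell2" unfolding \<chi>_def by (intro ell2_diff ell2_scale ell2_shift_right \<psi>)
  have "l2norm \<psi> \<le> l2norm \<chi> + l2norm (\<lambda>n. k * \<psi> (n - 1))"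
    unfolding \<chi>_def by (intro l2norm_triangle_sub ell2_scale ell2_shift_right \<psi>)
  also have "l2norm (\<lambda>n. k * \<psi> (n - 1)) \<le> cmod k * l2norm \<psi>"
    using l2norm_scale_le[OF ell2_shift_right[OF \<psi>], of k] l2norm_shift_right[OF \<psi>] by simp
  finally have 1: "(1 - cmod k) * l2norm \<psi> \<le> l2norm \<chi>" by (simp add: algebra_simps)
  let ?L = "\<lambda>n. if n = 0 then 0 else \<chi> (Suc n)"
  have eq: "(\<lambda>n. \<chi> n - k * ?L n) = (\<lambda>n. (- k) * T n)"
  proof
    fix n
    show "\<chi> n - k * ?L n = (- k) * T n"
      using k ell2_0[OF \<psi>]
      by (cases n) (auto simp: \<chi>_def T_def shiftop_JV_Suc shiftop_JV_0 field_simps)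
  qed
  have "l2norm \<chi> \<le> l2norm (\<lambda>n. \<chi> n - k * ?L n) + l2norm (\<lambda>n. k * ?L n)"
    by (intro l2norm_triangle_sub ell2_scale ell2_shift_left \<chi>)
  also have "l2norm (\<lambda>n. k * ?L n) \<le> cmod k * l2norm ?L"
    by (intro l2norm_scale_le ell2_shift_left \<chi>)
  also have "\<dots> \<le> cmod k * l2norm \<chi>"
    by (intro mult_left_mono l2norm_shift_left \<chi>) simp
  also have "l2norm (\<lambda>n. \<chi> n - k * ?L n) \<le> cmod k * l2norm T"
    unfolding eq using l2norm_scale_le[OF T, of "- k"] by simp
  also have "\<dots> \<le> 1 * l2norm T"
    using k l2norm_nonneg[OF T] by (intro mult_right_mono) auto
  finally have 2: "(1 - cmod k) * l2norm \<chi> \<le> l2norm T" by (simp add: algebra_simps)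
  have "(1 - cmod k)\<^sup>2 * l2norm \<psi> = (1 - cmod k) * ((1 - cmod k) * l2norm \<psi>)"
    by (simp add: power2_eq_square)
  also have "\<dots> \<le> (1 - cmod k) * l2norm \<chi>" using 1 k by (intro mult_left_mono) auto
  also note 2
  finally show ?thesis using k unfolding T_def[symmetric] by (simp add: field_simps)
qed

section \<open>The substitution z = k + 1 / k\<close>

text \<open>The two roots of k^2 - z k + 1 have product 1, so one lies in the closed unit disc. If
  it is unimodular, then \<open>1 / k = cnj k\<close> and z = 2 Re k lies in the interval.\<close>

lemma joukowski_surj:
  obtains k :: complex where "k \<noteq> 0" "cmod k \<le> 1" "z = k + 1 / k"
    "z \<notin> complex_of_real ` {-2..2} \<Longrightarrow> cmod k < 1"
proof -
  define w where "w = csqrt (z\<^sup>2 - 4)"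
  define k1 where "k1 = (z + w) / 2"
  define k2 where "k2 = (z - w) / 2"
  have "w\<^sup>2 = z\<^sup>2 - 4" by (simp add: w_def)
  then have p: "k1 * k2 = 1" by (simp add: k1_def k2_def field_simps power2_eq_square)
  have s: "z = k1 + k2" by (simp add: k1_def k2_def field_simps)
  have "cmod k1 * cmod k2 = 1" using p by (metis norm_mult norm_one)
  then have "cmod k1 \<le> 1 \<or> cmod k2 \<le> 1"
    by (metis less_1_mult less_irrefl linorder_not_le)
  moreover have "1 / k1 = k2" "1 / k2 = k1" "k1 \<noteq> 0" "k2 \<noteq> 0"
    using p by (auto simp: divide_eq_eq mult.commute)
  ultimately obtain k where k: "k \<noteq> 0" "cmod k \<le> 1" "z = k + 1 / k"
    using s by (metis add.commute)
  have "z \<in> complex_of_real ` {-2..2}" if "cmod k = 1"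
  proof -
    have "k * cnj k = 1" using complex_norm_square[of k] that by simp
    then have "1 / k = cnj k" using k(1) by (simp add: field_simps)
    then have "z = of_real (2 * Re k)" using k(3) by (simp add: complex_eq_iff)
    moreover have "2 * Re k \<in> {-2..2}" using abs_Re_le_cmod[of k] that by auto
    ultimately show ?thesis by blast
  qed
  with k that show thesis by (metis order_le_less)
qed

lemma unimodular_root:
  assumes "z \<in> complex_of_real ` {-2..2}"
  obtains k :: complex where "cmod k = 1" "z * k = k\<^sup>2 + 1"
proof -
  obtain x where x: "z = of_real x" "-2 \<le> x" "x \<le> 2" using assms by auto
  \<comment> \<open>With x = 2 cos t this is the point exp(i t) of the upper half circle.\<close>
  define k where "k = Complex (x / 2) (sqrt (1 - (x / 2)\<^sup>2))"
  have "(x / 2)\<^sup>2 \<le> 1" using x by (simp add: abs_square_le_1)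
  then have s: "(sqrt (1 - (x / 2)\<^sup>2))\<^sup>2 = 1 - (x / 2)\<^sup>2" by simp
  have "cmod k = 1" unfolding k_def cmod_def by (simp add: s)
  moreover have "z * k = k\<^sup>2 + 1"
    using s by (simp add: k_def x complex_eq_iff power2_eq_square algebra_simps)
  ultimately show thesis by (rule that)
qed

lemma norm_sums_le:
  fixes f :: "nat \<Rightarrow> 'a::real_normed_vector"
  assumes "f sums s" and "\<And>N. (\<Sum>n<N. norm (f n)) \<le> B"
  shows "norm s \<le> B"
proof (rule LIMSEQ_le_const2)
  show "(\<lambda>N. norm (\<Sum>n<N. f n)) \<longlonglongrightarrow> norm s" using assms(1) unfolding sums_def by (rule tendsto_norm)
  show "\<exists>N. \<forall>n\<ge>N. norm (\<Sum>n<n. f n) \<le> B"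
    using assms(2) norm_sum order_trans by blast
qed

section \<open>Maximum principle and absence of eigenvectors\<close>

context hardy
begin

text \<open>The boundary term of the finite formula vanishes in the limit: beyond \<open>m\<close>
  the kernel is bounded by its diagonal value at \<open>k = 1\<close>, and \<open>\<psi>\<close>
  tends to 0. Thus the unit circle is included.\<close>

lemma green_representation:
  assumes \<psi>: "\<psi> \<in> ell2" and k: "k \<noteq> 0" "cmod k \<le> 1" and m: "m \<ge> 1"
  shows "(\<lambda>n. green (of_real a) k m (Suc n) *
      (\<psi> n + \<psi> (Suc (Suc n)) + ((if n = 0 then of_real a else 0) - (k + 1 / k)) * \<psi> (Suc n))) sums (- \<psi> m)"
    (is "?f sums _")
proof -
  let ?G = "green (complex_of_real a) k m" and ?B = "jost_quot a 1 (m - 1)"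
  have GB: "cmod (?G N) \<le> ?B" if "N \<ge> m" for N
  proof -
    have "cmod (?G N) \<le> green a 1 m N" by (rule norm_green_le[OF a k(2)])
    also have "green a 1 m N = ?B" using that m by (simp add: green_def min_def)
    finally show ?thesis .
  qed
  have \<psi>0: "\<psi> \<longlonglongrightarrow> 0" by (rule ell2_tendsto_0[OF \<psi>])
  have "(\<lambda>N. ?G N * \<psi> (Suc N) - ?G (Suc N) * \<psi> N) \<longlonglongrightarrow> 0"
  proof (rule tendsto_norm_zero_cancel, rule tendsto_sandwich[OF always_eventually])
    show "\<forall>N. 0 \<le> cmod (?G N * \<psi> (Suc N) - ?G (Suc N) * \<psi> N)" by simp
    have "cmod (?G N * \<psi> (Suc N) - ?G (Suc N) * \<psi> N) \<le> ?B * cmod (\<psi> (Suc N)) + ?B * cmod (\<psi> N)"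
      if "N \<ge> m" for N
      using norm_triangle_ineq4[of "?G N * \<psi> (Suc N)" "?G (Suc N) * \<psi> N"]
        mult_right_mono[OF GB[of N] norm_ge_zero[of "\<psi> (Suc N)"]]
        mult_right_mono[OF GB[of "Suc N"] norm_ge_zero[of "\<psi> N"]] that
      unfolding norm_mult by simp
    then show "\<forall>\<^sub>F N in sequentially. cmod (?G N * \<psi> (Suc N) - ?G (Suc N) * \<psi> N)
        \<le> ?B * cmod (\<psi> (Suc N)) + ?B * cmod (\<psi> N)"
      unfolding eventually_sequentially by blast
    have "(\<lambda>N. ?B * cmod (\<psi> (Suc N)) + ?B * cmod (\<psi> N)) \<longlonglongrightarrow> ?B * cmod 0 + ?B * cmod 0"
      by (intro tendsto_intros \<psi>0 LIMSEQ_Suc)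
    then show "(\<lambda>N. ?B * cmod (\<psi> (Suc N)) + ?B * cmod (\<psi> N)) \<longlonglongrightarrow> 0" by simp
  qed simp
  then have "(\<lambda>N. - \<psi> m + (?G N * \<psi> (Suc N) - ?G (Suc N) * \<psi> N)) \<longlonglongrightarrow> - \<psi> m + 0"
    by (intro tendsto_intros)
  moreover have "\<forall>\<^sub>F N in sequentially. - \<psi> m + (?G N * \<psi> (Suc N) - ?G (Suc N) * \<psi> N) = (\<Sum>n<N. ?f n)"
    unfolding eventually_sequentially
    using green_representation_finite[OF k(1) norm_jost_quot_0_le(2)[OF a k(2)] m, of _ \<psi>] ell2_0[OF \<psi>]
    by (metis (no_types, lifting))
  ultimately show ?thesis unfolding sums_def by (simp add: tendsto_cong)
qed

text \<open>The quotient of |\<psi>| by n^q tends to 0, as n^q is at least 1. Unless it vanishes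
  identically, only finitely many sites compete for the supremum.\<close>

lemma weighted_max:
  assumes \<psi>: "\<psi> \<in> ell2"
  obtains i M where "0 \<le> M" "cmod (\<psi> (Suc i)) = M * real (Suc i) powr q"
    "\<And>n. cmod (\<psi> (Suc n)) \<le> M * real (Suc n) powr q"
proof -
  define f where "f = (\<lambda>n. cmod (\<psi> (Suc n)) / real (Suc n) powr q)"
  have f: "cmod (\<psi> (Suc n)) = f n * real (Suc n) powr q" "0 \<le> f n" for n by (auto simp: f_def)
  have "\<exists>i. \<forall>n. f n \<le> f i"
  proof (cases "\<exists>j. f j > 0")
    case True
    then obtain j where j: "f j > 0" by blast
    have "(\<lambda>n. cmod (\<psi> (Suc n))) \<longlonglongrightarrow> 0"
      using ell2_tendsto_0[OF \<psi>] LIMSEQ_Suc tendsto_norm_zero by blast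
    then have "\<forall>\<^sub>F n in sequentially. cmod (\<psi> (Suc n)) < f j" using j by (rule order_tendstoD)
    then obtain N where N: "\<And>n. n \<ge> N \<Longrightarrow> cmod (\<psi> (Suc n)) < f j" by (auto simp: eventually_sequentially)
    have fN: "f n < f j" if "n \<ge> N" for n
    proof -
      have "f n \<le> cmod (\<psi> (Suc n))"
        unfolding f_def using one_le_powr[of n] by (simp add: divide_le_eq mult_left_le_one_le mult_le_cancel_left1)
      then show ?thesis using N[OF that] by simp
    qed
    let ?S = "f ` {..N + j}"
    have "Max ?S \<in> ?S" by (intro Max_in) auto
    then obtain i where i: "Max ?S = f i" by (rule imageE)
    have le: "f n \<le> f i" if "n \<le> N + j" for n unfolding i[symmetric] using that by (intro Max_ge) auto
    have "f n \<le> f i" for n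
    proof (cases "n \<le> N + j")
      case False
      then show ?thesis using fN[of n] le[of j] by simp
    qed (rule le)
    then show ?thesis by blast
  next
    case False
    then show ?thesis by (meson f(2) linorder_not_le order_trans)
  qed
  then obtain i where i: "\<And>n. f n \<le> f i" by blast
  show thesis by (rule that[of "f i" i]) (use f i in \<open>auto intro: mult_right_mono\<close>)
qed

text \<open>If \<open>|\<psi>| / n\<^sup>q\<close> is maximal at \<open>m\<close>, then the Green representation and the Hardy
  inequality bound \<open>|\<psi>\<^sub>m|\<close> by itself, and strictly so because \<open>\<psi>\<close> tends to zero.\<close>

lemma no_eigenvector:
  assumes v: "\<And>n. cmod (v (Suc n)) \<le> hardy_weight a q (Suc n)"
    and \<psi>: "\<psi> \<in> ell2" and ev: "shiftop (JV a v) z \<psi> = (\<lambda>_. 0)"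
  shows "\<psi> = (\<lambda>_. 0)"
proof -
  obtain i M where M: "0 \<le> M" "cmod (\<psi> (Suc i)) = M * real (Suc i) powr q"
    "\<And>n. cmod (\<psi> (Suc n)) \<le> M * real (Suc n) powr q"
    using weighted_max[OF \<psi>] by blast
  have "M = 0"
  proof (rule ccontr)
    assume "M \<noteq> 0"
    with M have "M > 0" by simp
    obtain k where k: "k \<noteq> 0" "cmod k \<le> 1" "z = k + 1 / k" using joukowski_surj[of z] by blast
    define h where "h = (\<lambda>n. \<psi> n + \<psi> (Suc (Suc n)) + ((if n = 0 then of_real a else 0) - (k + 1 / k)) * \<psi> (Suc n))"
    define t where "t = (\<lambda>n. green a 1 (Suc i) (Suc n) * (hardy_weight a q (Suc n) * real (Suc n) powr q))"
    define u where "u = (\<lambda>n. green a 1 (Suc i) (Suc n) * (hardy_weight a q (Suc n) * cmod (\<psi> (Suc n))))"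
    have u0: "0 \<le> u n" for n
      unfolding u_def using green_ge_one[of "Suc i" n] weight_nonneg[of n] by simp
    have h: "cmod (h n) \<le> hardy_weight a q (Suc n) * cmod (\<psi> (Suc n))" for n
    proof -
      have "h n = - v (Suc n) * \<psi> (Suc n)"
        using fun_cong[OF ev, of "Suc n"] unfolding shiftop_JV_Suc h_def k(3)[symmetric]
        by (simp add: eq_neg_iff_add_eq_0)
      then show ?thesis using v by (simp add: norm_mult mult_right_mono)
    qed
    have fu: "cmod (green (of_real a) k (Suc i) (Suc n) * h n) \<le> u n" for n
      unfolding norm_mult u_def
      using green_ge_one[of "Suc i" n] by (intro mult_mono norm_green_le a k h) auto
    have ut: "u n \<le> M * t n" for n
    proof -
      have "u n \<le> green a 1 (Suc i) (Suc n) * (hardy_weight a q (Suc n) * (M * real (Suc n) powr q))"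
        unfolding u_def using green_ge_one[of "Suc i" n] by (intro mult_left_mono M weight_nonneg) auto
      then show ?thesis by (simp add: t_def mult_ac)
    qed
    have "\<forall>\<^sub>F n in sequentially. cmod (\<psi> (Suc n)) < M"
      using tendsto_norm_zero[OF LIMSEQ_Suc[OF ell2_tendsto_0[OF \<psi>]]] \<open>M > 0\<close> by (rule order_tendstoD)
    then obtain N0 where N0: "\<And>n. n \<ge> N0 \<Longrightarrow> cmod (\<psi> (Suc n)) < M" by (auto simp: eventually_sequentially)
    \<comment> \<open>The successor ensures \<open>Suc l \<ge> 2\<close>, where the weight is
      strictly positive; at the first site it may be 0.\<close>
    define l where "l = Suc N0"
    have "u l < M * t l"
    proof -
      have "cmod (\<psi> (Suc l)) < M" by (rule N0) (simp add: l_def)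
      also have "M \<le> M * real (Suc l) powr q" using one_le_powr[of l] \<open>M > 0\<close> by simp
      finally have "cmod (\<psi> (Suc l)) < M * real (Suc l) powr q" .
      moreover have "0 < hardy_weight a q (Suc l)" using hardy_weight_pos[of q "Suc l" a] q by (simp add: l_def)
      ultimately have "u l < green a 1 (Suc i) (Suc l) * (hardy_weight a q (Suc l) * (M * real (Suc l) powr q))"
        unfolding u_def using green_ge_one[of "Suc i" l] by (intro mult_strict_left_mono) auto
      then show ?thesis by (simp add: t_def mult_ac)
    qed
    \<comment> \<open>The gap \<open>M * t l - u l > 0\<close> at one site persists in the whole sum
      and contradicts the equality at the maximal site \<open>Suc i\<close>.\<close>
    moreover have "cmod (- \<psi> (Suc i)) \<le> M * real (Suc i) powr q - (M * t l - u l)"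
    proof (rule norm_sums_le)
      show "(\<lambda>n. green (of_real a) k (Suc i) (Suc n) * h n) sums (- \<psi> (Suc i))"
        unfolding h_def by (intro green_representation \<psi> k) simp
      fix N
      have "(\<Sum>n<N. cmod (green (of_real a) k (Suc i) (Suc n) * h n)) \<le> (\<Sum>n<N. u n)"
        by (intro sum_mono fu)
      also have "\<dots> \<le> (\<Sum>n<N + Suc l. u n)" by (intro sum_mono2 u0) auto
      also have "\<dots> = M * (\<Sum>n<N + Suc l. t n) - (\<Sum>n<N + Suc l. M * t n - u n)"
        unfolding sum_subtractf sum_distrib_left by simp
      also have "\<dots> \<le> M * real (Suc i) powr q - (M * t l - u l)"
      proof (rule diff_mono)
        show "M * (\<Sum>n<N + Suc l. t n) \<le> M * real (Suc i) powr q"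
          unfolding t_def by (intro mult_left_mono green_hardy_sum_le M) simp
        show "M * t l - u l \<le> (\<Sum>n<N + Suc l. M * t n - u n)"
          by (rule member_le_sum) (use ut in auto)
      qed
      finally show "(\<Sum>n<N. cmod (green (of_real a) k (Suc i) (Suc n) * h n))
          \<le> M * real (Suc i) powr q - (M * t l - u l)" .
    qed
    ultimately show False using M(2) by simp
  qed
  then have "\<psi> (Suc n) = 0" for n using M(3)[of n] by simp
  then show ?thesis using ell2_0[OF \<psi>] by (metis not0_implies_Suc ext)
qed

end

subsection \<open>Resolvent set and spectrum\<close>

text \<open>Controls the row sums of the Green kernel for \<open>cmod k < 1\<close>: splitting at
  \<open>n = m\<close> leaves a geometric series on each side.\<close>

lemma sum_power_abs_diff_le:
  fixes r :: real
  assumes r: "0 \<le> r" "r < 1"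
  shows "(\<Sum>n<N. r ^ ((m - n) + (n - m))) \<le> 2 / (1 - r)"
proof -
  have geo: "(\<Sum>n<K. r ^ n) \<le> 1 / (1 - r)" for K
    using r sum_le_suminf[OF summable_geometric[of r], of "{..<K}"] suminf_geometric[of r] by simp
  have "(\<Sum>n<N. r ^ ((m - n) + (n - m))) \<le> (\<Sum>n<m + N. r ^ ((m - n) + (n - m)))"
    using r by (intro sum_mono2) auto
  also have "\<dots> = (\<Sum>n<m. r ^ ((m - n) + (n - m))) + (\<Sum>n<N. r ^ ((m - (m + n)) + (m + n - m)))"
    by (induction N) simp_all
  also have "(\<Sum>n<m. r ^ ((m - n) + (n - m))) \<le> (\<Sum>n<m. r ^ (m - Suc n))"
    using r by (intro sum_mono power_decreasing) auto
  also have "\<dots> = (\<Sum>n<m. r ^ n)" by (rule sum.nat_diff_reindex)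
  also have "\<dots> \<le> 1 / (1 - r)" by (rule geo)
  also have "(\<Sum>n<N. r ^ ((m - (m + n)) + (m + n - m))) \<le> 1 / (1 - r)" using geo[of N] by simp
  finally show ?thesis by simp
qed

context hardy
begin

lemma hardy_weight_le_2: "hardy_weight a q n \<le> 2"
proof -
  have "0 \<le> (1 - 1 / real n) powr q" "0 \<le> (1 + 1 / real n) powr q" "0 \<le> a * (if n = 1 then 1 else 0)"
    using a by auto
  then show ?thesis unfolding hardy_weight_def by linarith
qed

lemma shiftop_ell2:
  assumes "\<And>n. cmod (v (Suc n)) \<le> hardy_weight a q (Suc n)" and "\<psi> \<in> ell2"
  shows "shiftop (JV a v) z \<psi> \<in> ell2"
  using assms order_trans[OF assms(1) hardy_weight_le_2] by (intro shiftop_JV_ell2[of _ _ 2])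

section \<open>Injectivity and dense range\<close>

lemma inj_on_shiftop:
  assumes v: "\<And>n. cmod (v (Suc n)) \<le> hardy_weight a q (Suc n)"
  shows "inj_on (shiftop (JV a v) z) ell2"
proof (rule inj_onI)
  fix x y assume xy: "x \<in> ell2" "y \<in> ell2" "shiftop (JV a v) z x = shiftop (JV a v) z y"
  then have "shiftop (JV a v) z (\<lambda>n. x n - y n) = (\<lambda>_. 0)" by (simp add: shiftop_JV_diff)
  then have "(\<lambda>n. x n - y n) = (\<lambda>_. 0)" using no_eigenvector[OF v ell2_diff[OF xy(1,2)]] by blast
  then show "x = y" by (metis eq_iff_diff_eq_0 ext)
qed

text \<open>A vector orthogonal to the range lies in the kernel of the adjoint, which is the same
  operator with conjugated potential and spectral parameter. Conjugation preserves the bound on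
  \<open>v\<close>, so \<open>no_eigenvector\<close> applies.\<close>

lemma dense_range:
  assumes v: "\<And>n. cmod (v (Suc n)) \<le> hardy_weight a q (Suc n)" and \<phi>: "\<phi> \<in> ell2" and "\<epsilon> > 0"
  shows "\<exists>\<psi>\<in>ell2. l2norm (\<lambda>n. \<phi> n - shiftop (JV a v) z \<psi> n) < \<epsilon>"
proof -
  let ?T = "shiftop (JV a v) z"
  have "\<exists>w\<in>?T ` ell2. l2norm (\<lambda>n. \<phi> n - w n) < \<epsilon>"
  proof (rule dense_subspace_criterion)
    show "?T ` ell2 \<subseteq> ell2" using shiftop_ell2[OF v] by blast
    show "(\<lambda>_. 0) \<in> ?T ` ell2"
      by (rule image_eqI[of _ _ "\<lambda>_. 0"]) (auto simp: shiftop_def JV_def ell2_def)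
    show "(\<lambda>n. x n + y n) \<in> ?T ` ell2" if "x \<in> ?T ` ell2" "y \<in> ?T ` ell2" for x y
      using that shiftop_JV_add[of a v z] ell2_add by (auto simp: image_iff) metis
    show "(\<lambda>n. c * x n) \<in> ?T ` ell2" if "x \<in> ?T ` ell2" for x c
      using that shiftop_JV_scale[of a v z c] ell2_scale by (auto simp: image_iff) metis
    fix r assume r: "r \<in> ell2" and min: "\<And>w. w \<in> ?T ` ell2 \<Longrightarrow> l2norm r \<le> l2norm (\<lambda>n. r n - w n)"
    have "shiftop (JV a (\<lambda>n. cnj (v n))) (cnj z) r (Suc i) = 0" for i
    proof -
      define e :: "nat \<Rightarrow> complex" where "e = (\<lambda>n. if n = Suc i then 1 else 0)"
      have e: "e \<in> ell2"
        using summable_finite[of "{Suc i}" "\<lambda>n. (cmod (e n))\<^sup>2"] by (auto simp: ell2_def e_def)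
      have sc: "(\<lambda>n. t * ?T e n) \<in> ?T ` ell2" for t
        unfolding shiftop_JV_scale[symmetric] using ell2_scale[OF e] by blast
      \<comment> \<open>The image of the unit vector at \<open>Suc i\<close> lives on the sites
        \<open>i\<close> to \<open>i + 2\<close>; pairing it with \<open>r\<close> yields row
        \<open>Suc i\<close> of the adjoint equation. For \<open>i = 0\<close> the first of these is
        the dummy index, where \<open>r\<close> is 0.\<close>
      have z: "?T e n = 0" if "n < i \<or> n \<ge> Suc (Suc (Suc i))" for n
        using that by (auto simp: e_def shiftop_def JV_def)
      have sum0: "(\<Sum>n<Suc (Suc (Suc i)). cnj (?T e n) * r n) = 0"
        by (rule orthogonal_of_minimal[OF r shiftop_ell2[OF v e] _ min[OF sc]]) (simp add: z)
      have s1: "(\<Sum>n<i. cnj (?T e n) * r n) = 0" by (intro sum.neutral) (simp add: z)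
      have s2: "cnj (?T e i) * r i = r i"
        using ell2_0[OF r] by (cases i) (auto simp: e_def shiftop_def JV_def)
      have s3: "cnj (?T e (Suc i)) = (if i = 0 then of_real a else 0) - cnj z + cnj (v (Suc i))"
        unfolding shiftop_JV_Suc by (simp add: e_def)
      have s4: "cnj (?T e (Suc (Suc i))) = 1" unfolding shiftop_JV_Suc by (simp add: e_def)
      show ?thesis
        using sum0 unfolding sum.lessThan_Suc s1 s2 s3 s4 unfolding shiftop_JV_Suc by (simp add: algebra_simps)
    qed
    then have "shiftop (JV a (\<lambda>n. cnj (v n))) (cnj z) r n = 0" for n
      using ell2_0[OF r] by (cases n) (auto simp: shiftop_JV_0)
    then show "r = (\<lambda>_. 0)"
      using no_eigenvector[of "\<lambda>n. cnj (v n)" r "cnj z"] v r by auto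
  qed (use \<phi> \<open>\<epsilon> > 0\<close> in auto)
  then show ?thesis by blast
qed

section \<open>Lower bound and resolvent off the interval\<close>

text \<open>Maximum principle with a source: at the maximal site of |\<psi>| / n^q the Hardy
  inequality bounds the potential's contribution by \<open>c\<close> times the left side, which is
  absorbed because \<open>c < 1\<close>. The source is bounded by its sup norm times the row sum
  bound \<open>D\<close>, finite because \<open>cmod k < 1\<close>.\<close>

lemma weighted_sup_bound:
  assumes c: "0 \<le> c" "c < 1" and v: "\<And>n. cmod (v (Suc n)) \<le> c * hardy_weight a q (Suc n)"
    and k: "k \<noteq> 0" "cmod k < 1"
  obtains C where "0 \<le> C"
    "\<And>\<psi> n. \<psi> \<in> ell2 \<Longrightarrow>
       cmod (\<psi> (Suc n)) \<le> C * l2norm (shiftop (JV a v) (k + 1 / k) \<psi>) * real (Suc n) powr q"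
proof -
  define P where "P = 1 / (1 - a) + 1 / (1 - (cmod k)\<^sup>2)"
  define D where "D = P * (2 / (1 - cmod k))"
  have v': "cmod (v (Suc n)) \<le> hardy_weight a q (Suc n)" for n
    using v[of n] mult_right_mono[of c 1 "hardy_weight a q (Suc n)"] weight_nonneg[of n] c by simp
  have P0: "0 \<le> P" using a k by (simp add: P_def power_le_one)
  then have D0: "0 \<le> D" using k by (simp add: D_def)
  have G: "cmod (green (of_real a) k m (Suc n)) \<le> P * cmod k ^ ((m - Suc n) + (Suc n - m))" for m n
  proof -
    have "cmod (green (of_real a) k m (Suc n)) =
        cmod (jost_quot (of_real a) k (min (m - 1) n)) * cmod k ^ Suc ((m - Suc n) + (Suc n - m))"
      unfolding green_def by (simp add: norm_mult norm_power)
    also have "\<dots> \<le> P * cmod k ^ ((m - Suc n) + (Suc n - m))"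
      using k P0 norm_jost_quot_le_uniform[OF a k(2)] unfolding P_def[symmetric]
      by (intro mult_mono power_decreasing) auto
    finally show ?thesis .
  qed
  have "cmod (\<psi> (Suc n)) \<le> D / (1 - c) * l2norm (shiftop (JV a v) (k + 1 / k) \<psi>) * real (Suc n) powr q"
    if \<psi>: "\<psi> \<in> ell2" for \<psi> n
  proof -
    define \<phi> where "\<phi> = shiftop (JV a v) (k + 1 / k) \<psi>"
    have \<phi>: "\<phi> \<in> ell2" unfolding \<phi>_def by (rule shiftop_ell2[OF v' \<psi>])
    obtain i M where M: "0 \<le> M" "cmod (\<psi> (Suc i)) = M * real (Suc i) powr q"
      "\<And>n. cmod (\<psi> (Suc n)) \<le> M * real (Suc n) powr q"
      using weighted_max[OF \<psi>] by blast
    let ?G = "green (complex_of_real a) k (Suc i)"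
    define h where "h = (\<lambda>n. \<psi> n + \<psi> (Suc (Suc n)) + ((if n = 0 then of_real a else 0) - (k + 1 / k)) * \<psi> (Suc n))"
    define t where "t = (\<lambda>n. green a 1 (Suc i) (Suc n) * (hardy_weight a q (Suc n) * real (Suc n) powr q))"
    define s where "s = (\<lambda>n. cmod k ^ ((Suc i - Suc n) + (Suc n - Suc i)))"
    have summand: "cmod (?G (Suc n) * h n) \<le> P * l2norm \<phi> * s n + c * M * t n" for n
    proof -
      have "h n = \<phi> (Suc n) - v (Suc n) * \<psi> (Suc n)" by (simp add: h_def \<phi>_def shiftop_JV_Suc)
      then have "cmod (?G (Suc n) * h n) \<le> cmod (?G (Suc n) * \<phi> (Suc n)) + cmod (?G (Suc n) * (v (Suc n) * \<psi> (Suc n)))"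
        using norm_triangle_ineq4[of "?G (Suc n) * \<phi> (Suc n)" "?G (Suc n) * (v (Suc n) * \<psi> (Suc n))"]
        by (simp add: right_diff_distrib)
      also have "cmod (?G (Suc n) * \<phi> (Suc n)) \<le> (P * s n) * l2norm \<phi>"
        unfolding norm_mult s_def using P0 by (intro mult_mono G norm_le_l2norm \<phi>) auto
      also have "cmod (?G (Suc n) * (v (Suc n) * \<psi> (Suc n)))
          \<le> green a 1 (Suc i) (Suc n) * ((c * hardy_weight a q (Suc n)) * (M * real (Suc n) powr q))"
        unfolding norm_mult using green_ge_one[of "Suc i" n] c weight_nonneg[of n] k
        by (intro mult_mono norm_green_le a v M) auto
      also have "\<dots> = c * M * t n" by (simp add: t_def)
      finally show ?thesis by (simp add: mult_ac)
    qed
    have "cmod (- \<psi> (Suc i)) \<le> D * l2norm \<phi> + c * M * real (Suc i) powr q"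
    proof (rule norm_sums_le)
      show "(\<lambda>n. ?G (Suc n) * h n) sums (- \<psi> (Suc i))"
        unfolding h_def using k by (intro green_representation \<psi>) auto
      fix N
      have "(\<Sum>n<N. cmod (?G (Suc n) * h n)) \<le> (\<Sum>n<N. P * l2norm \<phi> * s n + c * M * t n)"
        by (intro sum_mono summand)
      also have "\<dots> = P * l2norm \<phi> * (\<Sum>n<N. s n) + c * M * (\<Sum>n<N. t n)"
        by (simp add: sum.distrib sum_distrib_left)
      also have "\<dots> \<le> P * l2norm \<phi> * (2 / (1 - cmod k)) + c * M * real (Suc i) powr q"
      proof (intro add_mono mult_left_mono)
        show "(\<Sum>n<N. s n) \<le> 2 / (1 - cmod k)"
          using sum_power_abs_diff_le[of "cmod k" i N] k by (simp add: s_def)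
        show "(\<Sum>n<N. t n) \<le> real (Suc i) powr q"
          unfolding t_def by (rule green_hardy_sum_le) simp
      qed (use P0 l2norm_nonneg[OF \<phi>] c M in auto)
      finally show "(\<Sum>n<N. cmod (?G (Suc n) * h n)) \<le> D * l2norm \<phi> + c * M * real (Suc i) powr q"
        by (simp add: D_def mult_ac)
    qed
    then have "(1 - c) * (M * real (Suc i) powr q) \<le> D * l2norm \<phi>"
      using M(2) by (simp add: algebra_simps)
    moreover have "(1 - c) * (M * 1) \<le> (1 - c) * (M * real (Suc i) powr q)"
      using M c one_le_powr[of i] by (intro mult_left_mono) auto
    ultimately have "M \<le> D / (1 - c) * l2norm \<phi>" using c by (simp add: field_simps)
    then have "M * real (Suc n) powr q \<le> D / (1 - c) * l2norm \<phi> * real (Suc n) powr q"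
      by (intro mult_right_mono) auto
    then show ?thesis using M(3)[of n] unfolding \<phi>_def by linarith
  qed
  moreover have "0 \<le> D / (1 - c)" using D0 c by simp
  ultimately show thesis using that by blast
qed

text \<open>The free operator sends \<open>\<psi>\<close> to \<open>\<phi> - b\<close>, where
  \<open>b\<close> collects the boundary coupling and the potential. The weighted sup bound
  dominates \<open>b\<close> by \<open>C * l2norm \<phi>\<close> times a fixed \<open>w\<close> in
  \<open>ell2\<close>, so the free lower bound carries over.\<close>

lemma lower_bound:
  assumes c: "0 \<le> c" "c < 1" and v: "\<And>n. cmod (v (Suc n)) \<le> c * hardy_weight a q (Suc n)"
    and z: "z \<notin> complex_of_real ` {-2..2}"
  obtains C where "0 \<le> C" "\<And>\<psi>. \<psi> \<in> ell2 \<Longrightarrow> l2norm \<psi> \<le> C * l2norm (shiftop (JV a v) z \<psi>)"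
proof -
  obtain k where k: "k \<noteq> 0" "cmod k < 1" "z = k + 1 / k" using joukowski_surj[of z] z by blast
  have v': "cmod (v (Suc n)) \<le> hardy_weight a q (Suc n)" for n
    using v[of n] mult_right_mono[of c 1 "hardy_weight a q (Suc n)"] weight_nonneg[of n] c by simp
  obtain C where C: "0 \<le> C" "\<And>\<psi> n. \<psi> \<in> ell2 \<Longrightarrow>
       cmod (\<psi> (Suc n)) \<le> C * l2norm (shiftop (JV a v) z \<psi>) * real (Suc n) powr q"
    using weighted_sup_bound[OF c v k(1,2)] unfolding k(3)[symmetric] by blast
  define w where "w = (\<lambda>n. if n = 0 then 0 else
    complex_of_real ((a * (if n = 1 then 1 else 0) + hardy_weight a q n) * real n powr q))"
  have wn: "cmod (w (Suc n)) = (a * (if n = 0 then 1 else 0) + hardy_weight a q (Suc n)) * real (Suc n) powr q" for n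
    unfolding w_def using a weight_nonneg[of n] by (simp add: norm_mult del: of_real_add of_real_mult)
  have w: "w \<in> ell2"
  proof -
    have "summable (\<lambda>n. (if n = 0 then a else 0) + hardy_weight a q (Suc n) * real (Suc n) powr q)"
      using summable_finite[of "{0}" "\<lambda>n. if n = 0 then a else 0"]
      by (intro summable_add summable_hardy_weight_powr) auto
    also have "(\<lambda>n. (if n = 0 then a else 0) + hardy_weight a q (Suc n) * real (Suc n) powr q) = (\<lambda>n. cmod (w (Suc n)))"
      unfolding wn by (auto simp: algebra_simps)
    finally have sw: "summable (\<lambda>n. cmod (w (Suc n)))" .
    have "\<forall>\<^sub>F n in sequentially. cmod (w (Suc n)) < 1"
      using summable_LIMSEQ_zero[OF sw] by (rule order_tendstoD) simp
    then obtain N where "\<And>n. n \<ge> N \<Longrightarrow> cmod (w (Suc n)) < 1" by (auto simp: eventually_sequentially)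
    then have "summable (\<lambda>n. (cmod (w (Suc n)))\<^sup>2)"
      by (intro summable_comparison_test'[OF sw, of N])
        (auto simp: power2_eq_square intro!: mult_left_le dest: less_imp_le)
    then have "summable (\<lambda>n. (cmod (w n))\<^sup>2)" by (subst (asm) summable_Suc_iff)
    then show ?thesis by (simp add: ell2_def w_def)
  qed
  define F where "F = 1 / (1 - cmod k)\<^sup>2"
  have F: "0 \<le> F" by (simp add: F_def)
  have "l2norm \<psi> \<le> F * (1 + C * l2norm w) * l2norm (shiftop (JV a v) z \<psi>)" if \<psi>: "\<psi> \<in> ell2" for \<psi>
  proof -
    define \<phi> where "\<phi> = shiftop (JV a v) z \<psi>"
    have \<phi>: "\<phi> \<in> ell2" unfolding \<phi>_def by (rule shiftop_ell2[OF v' \<psi>])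
    define b where "b = (\<lambda>n. if n = 0 then 0 else (of_real a * (if n = 1 then 1 else 0) + v n) * \<psi> n)"
    have bw: "cmod (b (Suc n)) \<le> (C * l2norm \<phi>) * cmod (w (Suc n))" for n
    proof -
      have "cmod (of_real a * (if n = 0 then 1 else 0) + v (Suc n)) \<le> a * (if n = 0 then 1 else 0) + hardy_weight a q (Suc n)"
        using norm_triangle_ineq[of "of_real a * (if n = 0 then 1 else 0)" "v (Suc n)"] v'[of n] a by auto
      then have "cmod (b (Suc n)) \<le> (a * (if n = 0 then 1 else 0) + hardy_weight a q (Suc n))
          * (C * l2norm \<phi> * real (Suc n) powr q)"
        unfolding b_def norm_mult using C(2)[OF \<psi>, of n] a weight_nonneg[of n]
        by (auto simp: norm_mult \<phi>_def intro!: mult_mono)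
      then show ?thesis unfolding wn by (simp add: mult_ac)
    qed
    have CB: "0 \<le> C * l2norm \<phi>" using C l2norm_nonneg[OF \<phi>] by simp
    have b: "b \<in> ell2" "l2norm b \<le> C * l2norm \<phi> * l2norm w"
      using ell2_dominated[OF w _ CB bw] l2norm_dominated[OF w _ CB bw] by (simp_all add: b_def)
    have eq: "shiftop (JV 0 (\<lambda>_. 0)) z \<psi> = (\<lambda>n. \<phi> n - b n)"
      unfolding \<phi>_def b_def by (rule ext) (auto simp: shiftop_def JV_def algebra_simps)
    have "l2norm \<psi> \<le> F * l2norm (\<lambda>n. \<phi> n - b n)"
      using free_lower_bound[OF k(1,2) \<psi>] unfolding k(3)[symmetric] eq F_def .
    also have "\<dots> \<le> F * (l2norm \<phi> + C * l2norm \<phi> * l2norm w)"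
      using l2norm_triangle_diff[OF \<phi> b(1)] b(2) F by (intro mult_left_mono) auto
    finally show ?thesis unfolding \<phi>_def by (simp add: algebra_simps)
  qed
  moreover have "0 \<le> F * (1 + C * l2norm w)" using F C l2norm_nonneg[OF w] by simp
  ultimately show thesis using that by blast
qed

text \<open>The lower bound turns approximate preimages of \<open>\<phi>\<close>, provided by the
  dense range, into a Cauchy sequence; its limit is an exact preimage.\<close>

lemma resolvent:
  assumes c: "0 \<le> c" "c < 1" and v: "\<And>n. cmod (v (Suc n)) \<le> c * hardy_weight a q (Suc n)"
    and z: "z \<notin> complex_of_real ` {-2..2}"
  shows "z \<in> resolvent_set (JV a v)"
proof -
  let ?T = "shiftop (JV a v) z"
  have v': "cmod (v (Suc n)) \<le> hardy_weight a q (Suc n)" for n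
    using v[of n] mult_right_mono[of c 1 "hardy_weight a q (Suc n)"] weight_nonneg[of n] c by simp
  obtain C where C: "0 \<le> C" "\<And>\<psi>. \<psi> \<in> ell2 \<Longrightarrow> l2norm \<psi> \<le> C * l2norm (?T \<psi>)"
    using lower_bound[OF c v z] by blast
  have "\<phi> \<in> ?T ` ell2" if \<phi>: "\<phi> \<in> ell2" for \<phi>
  proof -
    have "\<exists>\<psi>\<in>ell2. l2norm (\<lambda>n. \<phi> n - ?T \<psi> n) < inverse (real (Suc j))" for j
      by (rule dense_range[OF v' \<phi>]) simp
    then obtain f where f: "\<And>j. f j \<in> ell2" "\<And>j. l2norm (\<lambda>n. \<phi> n - ?T (f j) n) < inverse (real (Suc j))"
      by metis
    have Tf: "(\<lambda>n. \<phi> n - ?T (f j) n) \<in> ell2" for j by (intro ell2_diff \<phi> shiftop_ell2 v' f)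
    have Tlim: "(\<lambda>j. ?T (f j) n) \<longlonglongrightarrow> \<phi> n" for n
    proof (rule LIMSEQ_I)
      fix \<epsilon> :: real assume "\<epsilon> > 0"
      then obtain N where N: "\<And>j. j \<ge> N \<Longrightarrow> inverse (real (Suc j)) < \<epsilon>"
        using order_tendstoD(2)[OF LIMSEQ_inverse_real_of_nat, of \<epsilon>] by (auto simp: eventually_sequentially)
      have "norm (?T (f j) n - \<phi> n) < \<epsilon>" if "j \<ge> N" for j
        using norm_le_l2norm[OF Tf[of j], of n] f(2)[of j] N[OF that] by (simp add: norm_minus_commute)
      then show "\<exists>N. \<forall>j\<ge>N. norm (?T (f j) n - \<phi> n) < \<epsilon>" by blast
    qed
    obtain \<psi> where \<psi>: "\<psi> \<in> ell2" "\<And>n. (\<lambda>j. f j n) \<longlonglongrightarrow> \<psi> n"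
    proof (rule ell2_complete[of f, OF f(1)])
      fix \<epsilon> :: real assume "\<epsilon> > 0"
      then have "0 < \<epsilon> / (C + 1) / 2" using C by simp
      then obtain N where N: "\<And>j. j \<ge> N \<Longrightarrow> inverse (real (Suc j)) < \<epsilon> / (C + 1) / 2"
        using order_tendstoD(2)[OF LIMSEQ_inverse_real_of_nat] by (auto simp: eventually_sequentially)
      have "l2norm (\<lambda>n. f i n - f j n) < \<epsilon>" if "i \<ge> N" "j \<ge> N" for i j
      proof -
        have "l2norm (\<lambda>n. f i n - f j n) \<le> C * l2norm (\<lambda>n. ?T (f i) n - ?T (f j) n)"
          using C(2)[OF ell2_diff[OF f(1) f(1)]] by (simp add: shiftop_JV_diff)
        also have "l2norm (\<lambda>n. ?T (f i) n - ?T (f j) n) \<le> \<epsilon> / (C + 1)"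
        proof -
          have "l2norm (\<lambda>n. ?T (f i) n - ?T (f j) n)
              \<le> l2norm (\<lambda>n. \<phi> n - ?T (f j) n) + l2norm (\<lambda>n. \<phi> n - ?T (f i) n)"
            using l2norm_triangle_diff[OF Tf[of j] Tf[of i]] by simp
          also have "\<dots> \<le> \<epsilon> / (C + 1) / 2 + \<epsilon> / (C + 1) / 2"
            using f(2)[of i] f(2)[of j] N[OF that(1)] N[OF that(2)] by linarith
          also have "\<dots> = \<epsilon> / (C + 1)" by (rule field_sum_of_halves)
          finally show ?thesis .
        qed
        finally have "l2norm (\<lambda>n. f i n - f j n) \<le> C * (\<epsilon> / (C + 1))" using C by (simp add: mult_left_mono)
        also have "\<dots> < \<epsilon>" using C \<open>\<epsilon> > 0\<close> by (simp add: field_simps)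
        finally show ?thesis .
      qed
      then show "\<exists>N. \<forall>i\<ge>N. \<forall>j\<ge>N. l2norm (\<lambda>n. f i n - f j n) < \<epsilon>" by blast
    qed blast
    \<comment> \<open>Each coordinate of \<open>?T\<close> involves at most three coordinates, so
      coordinatewise convergence suffices.\<close>
    have "(\<lambda>j. ?T (f j) n) \<longlonglongrightarrow> ?T \<psi> n" for n
      unfolding shiftop_def JV_def by (cases "n = 0") (auto intro!: tendsto_intros \<psi>(2))
    then have "?T \<psi> = \<phi>" using Tlim LIMSEQ_unique by blast
    then show ?thesis using \<psi>(1) by blast
  qed
  then have "bij_betw ?T ell2 ell2"
    unfolding bij_betw_def using inj_on_shiftop[OF v'] shiftop_ell2[OF v'] by blast
  then show ?thesis unfolding resolvent_set_def using C(2) by blast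
qed

section \<open>The interval belongs to the spectrum\<close>

text \<open>Truncating k^n with |k| = 1 to the first \<open>L\<close> sites gives norm sqrt L. The
  images stay bounded in \<open>L\<close>: the free part errs only near the ends, and the potential
  is square summable. No resolvent bound survives this.\<close>

lemma interval_subset_spectrum:
  assumes v: "\<And>n. cmod (v (Suc n)) \<le> hardy_weight a q (Suc n)"
    and z: "z \<in> complex_of_real ` {-2..2}"
  shows "z \<in> op_spectrum (JV a v)"
proof (rule ccontr)
  assume "z \<notin> op_spectrum (JV a v)"
  then obtain C where C: "\<And>\<psi>. \<psi> \<in> ell2 \<Longrightarrow> l2norm \<psi> \<le> C * l2norm (shiftop (JV a v) z \<psi>)"
    by (auto simp: op_spectrum_def resolvent_set_def)
  obtain k where k: "cmod k = 1" "z * k = k\<^sup>2 + 1" using unimodular_root[OF z] by blast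
  define V where "V = (\<lambda>n. if n = 0 then 0 else v n)"
  have V: "V \<in> ell2"
  proof -
    have "summable (\<lambda>n. (cmod (v (Suc n)))\<^sup>2)"
    proof (rule summable_comparison_test'[OF summable_mult[OF summable_hardy_weight_powr, of 2], of 0])
      fix n
      have "(cmod (v (Suc n)))\<^sup>2 \<le> 2 * hardy_weight a q (Suc n)"
        unfolding power2_eq_square
        using v[of n] order_trans[OF v[of n] hardy_weight_le_2] by (intro mult_mono) auto
      also have "\<dots> \<le> 2 * (hardy_weight a q (Suc n) * real (Suc n) powr q)"
        using one_le_powr[of n] weight_nonneg[of n] by (simp add: mult_le_cancel_left1)
      finally show "norm ((cmod (v (Suc n)))\<^sup>2) \<le> 2 * (hardy_weight a q (Suc n) * real (Suc n) powr q)" by simp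
    qed
    then have "summable (\<lambda>n. (cmod (V (Suc n)))\<^sup>2)" by (simp add: V_def)
    then show ?thesis by (subst (asm) summable_Suc_iff) (simp add: ell2_def V_def)
  qed
  \<comment> \<open>10 will bound the free part and \<open>l2norm V\<close> the potential part; the
    absolute value is taken because the sign of \<open>C\<close> is unknown.\<close>
  define B where "B = \<bar>C\<bar> * (10 + l2norm V)"
  obtain L :: nat where L: "B\<^sup>2 < real L" using reals_Archimedean2 by blast
  then have L0: "L \<ge> 1" using zero_le_power2[of B] by (cases L) auto
  define \<psi> where "\<psi> = (\<lambda>n. if 1 \<le> n \<and> n \<le> L then k ^ n else 0)"
  have ps: "(\<lambda>n. (cmod (\<psi> n))\<^sup>2) sums (\<Sum>n\<in>{1..L}. (cmod (\<psi> n))\<^sup>2)"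
    by (rule sums_finite) (auto simp: \<psi>_def)
  have \<psi>: "\<psi> \<in> ell2" using ps by (auto simp: ell2_def sums_iff) (simp add: \<psi>_def)
  have \<psi>1: "cmod (\<psi> n) \<le> 1" for n by (simp add: \<psi>_def norm_power k)
  have "(\<Sum>n\<in>{1..L}. (cmod (\<psi> n))\<^sup>2) = (\<Sum>n\<in>{1..L}. 1)"
    by (intro sum.cong) (auto simp: \<psi>_def norm_power k)
  then have norm\<psi>: "(l2norm \<psi>)\<^sup>2 = real L" using ps \<psi> by (simp add: l2norm_power2 sums_iff)
  define E where "E = shiftop (JV a (\<lambda>_. 0)) z \<psi>"
  have E: "E \<in> ell2" unfolding E_def by (rule shiftop_JV_ell2[OF \<psi>, of _ 0]) simp
  have z2: "cmod z \<le> 2" using z by auto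
  \<comment> \<open>Each neighbour contributes at most 1, the diagonal at most
    \<open>1 + 2\<close>.\<close>
  have E5: "cmod (E n) \<le> 5" for n
  proof (cases n)
    case 0
    then show ?thesis using ell2_0[OF E] by simp
  next
    case (Suc i)
    let ?d = "(if i = 0 then of_real a else 0) - z"
    have "cmod ?d \<le> 3" using norm_triangle_ineq4[of "if i = 0 then of_real a else 0" z] z2 a by (auto split: if_splits)
    then have "cmod (?d * \<psi> (Suc i)) \<le> 3 * 1"
      unfolding norm_mult using \<psi>1 by (intro mult_mono) auto
    moreover have "cmod (E n) \<le> cmod (\<psi> i) + cmod (\<psi> (Suc (Suc i))) + cmod (?d * \<psi> (Suc i))"
      unfolding E_def Suc shiftop_JV_Suc
      using norm_triangle_ineq[of "\<psi> i + \<psi> (Suc (Suc i))" "?d * \<psi> (Suc i)"]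
        norm_triangle_ineq[of "\<psi> i" "\<psi> (Suc (Suc i))"] by simp
    ultimately show ?thesis using \<psi>1[of i] \<psi>1[of "Suc (Suc i)"] by linarith
  qed
  \<comment> \<open>In the interior \<open>k\<close> solves the free equation; \<open>Suc L\<close>
    is hit because the last entry spreads one site further.\<close>
  have E0: "E n = 0" if n: "n \<notin> {1, L, Suc L}" for n
  proof (cases n)
    case 0
    then show ?thesis using ell2_0[OF E] by simp
  next
    case (Suc i)
    show ?thesis
    proof (cases "n < L")
      case True
      then have "E n = k ^ i * (1 + k\<^sup>2 - z * k)"
        using n Suc unfolding E_def Suc shiftop_JV_Suc
        by (auto simp: \<psi>_def algebra_simps power2_eq_square)
      then show ?thesis by (simp add: k)
    next
      case False
      then show ?thesis using n Suc unfolding E_def Suc shiftop_JV_Suc by (auto simp: \<psi>_def)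
    qed
  qed
  have "(l2norm E)\<^sup>2 = (\<Sum>n\<in>{1, L, Suc L}. (cmod (E n))\<^sup>2)"
    unfolding l2norm_power2[OF E] by (rule suminf_finite) (use E0 in auto)
  also have "\<dots> \<le> of_nat (card {1, L, Suc L}) * 5\<^sup>2"
    by (intro sum_bounded_above power_mono E5) auto
  also have "\<dots> \<le> 3 * 5\<^sup>2"
  proof -
    have "card {1, L, Suc L} \<le> 3" by (simp add: card_insert_if)
    then show ?thesis by (intro mult_right_mono) simp_all
  qed
  also have "\<dots> \<le> 10\<^sup>2" by simp
  finally have E10: "l2norm E \<le> 10" by (rule power2_le_imp_le) simp
  have vp: "cmod (V (Suc n) * \<psi> (Suc n)) \<le> 1 * cmod (V (Suc n))" for n
    using \<psi>1[of "Suc n"] by (simp add: norm_mult mult_left_le)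
  have V\<psi>: "(\<lambda>n. V n * \<psi> n) \<in> ell2" "l2norm (\<lambda>n. V n * \<psi> n) \<le> 1 * l2norm V"
    using ell2_dominated[OF V _ zero_le_one vp] l2norm_dominated[OF V _ zero_le_one vp]
    by (simp_all add: V_def)
  have T: "shiftop (JV a v) z \<psi> = (\<lambda>n. E n + V n * \<psi> n)"
    unfolding E_def V_def by (rule ext) (auto simp: shiftop_def JV_def algebra_simps)
  have "l2norm (shiftop (JV a v) z \<psi>) \<le> 10 + l2norm V"
    unfolding T using l2norm_triangle[OF E V\<psi>(1)] V\<psi>(2) E10 by simp
  moreover have "0 \<le> l2norm (shiftop (JV a v) z \<psi>)" by (intro l2norm_nonneg shiftop_ell2 v \<psi>)
  ultimately have "C * l2norm (shiftop (JV a v) z \<psi>) \<le> B"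
    unfolding B_def by (intro mult_mono) auto
  then have "l2norm \<psi> \<le> B" using C[OF \<psi>] by simp
  then have "(l2norm \<psi>)\<^sup>2 \<le> B\<^sup>2" using l2norm_nonneg[OF \<psi>] by (intro power_mono)
  then show False using norm\<psi> L by simp
qed

end

theorem theorem5p10:
  fixes a q :: real and v :: "nat \<Rightarrow> complex"
  assumes "0 \<le> a" and "a < 1"
    and "0 < q" and "q \<le> min (log 2 (2 - a)) (1 / 2)"
  shows "((\<exists>c::real. c < 1 \<and> (\<forall>n\<ge>1. cmod (v n) \<le> c * hardy_weight a q n)) \<longrightarrow>
            op_spectrum (JV a v) = cont_spectrum (JV a v) \<and>
            cont_spectrum (JV a v) = complex_of_real ` {-2..2})
       \<and> ((\<forall>n\<ge>1. cmod (v n) \<le> hardy_weight a q n) \<longrightarrow> disc_spectrum (JV a v) = {})"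
proof (intro conjI impI)
  interpret hardy a q by standard (use assms in auto)
  {
    assume "\<forall>n\<ge>1. cmod (v n) \<le> hardy_weight a q n"
    then show "disc_spectrum (JV a v) = {}"
      using no_eigenvector[of v] by (auto simp: disc_spectrum_def is_eigenvalue_def)
  next
    assume "\<exists>c::real. c < 1 \<and> (\<forall>n\<ge>1. cmod (v n) \<le> c * hardy_weight a q n)"
    then obtain c' where c': "c' < 1" "\<And>n. cmod (v (Suc n)) \<le> c' * hardy_weight a q (Suc n)" by auto
    \<comment> \<open>\<open>c'\<close> may be negative, while the lemmas require a nonnegative
      constant; enlarging it is harmless as the weights are nonnegative.\<close>
    define c where "c = max c' 0"
    have c: "0 \<le> c" "c < 1" using c' by (auto simp: c_def)
    have v: "cmod (v (Suc n)) \<le> c * hardy_weight a q (Suc n)" for n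
      using c'(2)[of n] mult_right_mono[of c' c, OF _ weight_nonneg[of n]] by (simp add: c_def)
    have v': "cmod (v (Suc n)) \<le> hardy_weight a q (Suc n)" for n
      using v[of n] mult_right_mono[of c 1, OF _ weight_nonneg[of n]] c by simp
    have spec: "op_spectrum (JV a v) = complex_of_real ` {-2..2}"
      using resolvent[OF c v] interval_subset_spectrum[OF v'] by (auto simp: op_spectrum_def)
    \<comment> \<open>Injectivity and dense range hold for every \<open>z\<close>, so the whole
      spectrum is continuous.\<close>
    show eq: "op_spectrum (JV a v) = cont_spectrum (JV a v)"
      using inj_on_shiftop[OF v'] dense_range[OF v'] by (auto simp: cont_spectrum_def)
    show "cont_spectrum (JV a v) = complex_of_real ` {-2..2}" using spec eq by simp
  }
qed

end
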